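(* For all $\rho,\tau\in\mathbb{N}$, every graph $G$ with $\mathrm{tw}(G)<\tau$ and no induced minor isomorphic to $\mathrm{bin}_\rho$ satisfies $\mathrm{pw}(G)<\tau^{6\rho+2}$.
   Context: Graphs are finite and simple; $\mathbb{N}$ is the positive integers. $\mathrm{tw}$ and $\mathrm{pw}$ denote treewidth and pathwidth. An induced minor of $G$ is a graph obtained from $G$ by deleting vertices and contracting edges (removing loops and parallel edges). For $r\ge 0$, $\mathrm{bin}_r$ is the full binary tree of radius $r$: a rooted tree in which every vertex at distance less than $r$ from the root has exactly two children and all leaves are at distance exactly $r$ from the root. *)

theory Defs
  imports "Graph_Theory.Graph_Theory"
begin

text \<open>
  Finite simple graphs are \<^locale>\<open>pair_graph\<close>s: a finite vertex set together with a symmetric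
  irreflexive relation on it, so every undirected edge is present as two opposite arcs.
\<close>

subsection \<open>Treewidth and pathwidth\<close>

text \<open>
  The library's \<^const>\<open>forest\<close> and \<^const>\<open>tree\<close> are not usable here: in a symmetric digraph
  \<^const>\<open>forest\<close> counts the walk \<open>a, b, a\<close> along one undirected edge as a cycle.  Cycles of an
  undirected simple graph are exactly the library's cycles with at least three arcs.
  Note that \<^const>\<open>connected\<close> implies non-emptiness.
\<close>

definition undirected_tree :: "'a pair_pre_digraph \<Rightarrow> bool" where
  "undirected_tree T \<longleftrightarrow>
     pair_graph T \<and> connected T \<and> \<not> (\<exists>p. pre_digraph.cycle T p \<and> 3 \<le> length p)"

definition undirected_path :: "'a pair_pre_digraph \<Rightarrow> bool" where
  "undirected_path P \<longleftrightarrow>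
     (\<exists>vs. vs \<noteq> [] \<and> distinct vs \<and> pverts P = set vs \<and>
           parcs P = set (zip vs (tl vs)) \<union> (set (zip vs (tl vs)))\<inverse>)"

definition tree_decomposition ::
  "'a pair_pre_digraph \<Rightarrow> 't pair_pre_digraph \<Rightarrow> ('t \<Rightarrow> 'a set) \<Rightarrow> bool" where
  "tree_decomposition G T B \<longleftrightarrow>
     undirected_tree T \<and>
     (\<Union>t \<in> pverts T. B t) = pverts G \<and>
     (\<forall>(u, v) \<in> parcs G. \<exists>t \<in> pverts T. u \<in> B t \<and> v \<in> B t) \<and>
     (\<forall>v \<in> pverts G. connected (with_proj T \<restriction> {t \<in> pverts T. v \<in> B t}))"

definition path_decomposition ::
  "'a pair_pre_digraph \<Rightarrow> 't pair_pre_digraph \<Rightarrow> ('t \<Rightarrow> 'a set) \<Rightarrow> bool" where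
  "path_decomposition G P B \<longleftrightarrow> undirected_path P \<and> tree_decomposition G P B"

definition decomposition_width :: "'t pair_pre_digraph \<Rightarrow> ('t \<Rightarrow> 'a set) \<Rightarrow> int" where
  "decomposition_width T B = int (MAX t \<in> pverts T. card (B t)) - 1"

text \<open>
  As decomposition trees are finite, nothing is lost by taking their nodes to be natural numbers.
  The sets below are non-empty (use a single bag) and bounded below by \<open>-1\<close>, so the infima are
  minima; the null graph gets width \<open>-1\<close>.
\<close>

definition treewidth :: "'a pair_pre_digraph \<Rightarrow> int" where
  "treewidth G = Inf {decomposition_width T B | (T :: nat pair_pre_digraph) B.
                        tree_decomposition G T B}"

definition pathwidth :: "'a pair_pre_digraph \<Rightarrow> int" where
  "pathwidth G = Inf {decomposition_width P B | (P :: nat pair_pre_digraph) B.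
                        path_decomposition G P B}"

subsection \<open>Induced minors\<close>

definition delete_vertex :: "'a pair_pre_digraph \<Rightarrow> 'a \<Rightarrow> 'a pair_pre_digraph" where
  "delete_vertex G v =
     \<lparr> pverts = pverts G - {v}, parcs = {(x, y) \<in> parcs G. x \<noteq> v \<and> y \<noteq> v} \<rparr>"

text \<open>
  The vertex resulting from contracting \<open>uv\<close> keeps the name \<open>u\<close>.  Loops are removed explicitly;
  parallel edges are identified because \<^const>\<open>parcs\<close> is a set of pairs.
\<close>

definition contract_edge :: "'a pair_pre_digraph \<Rightarrow> 'a \<Rightarrow> 'a \<Rightarrow> 'a pair_pre_digraph" where
  "contract_edge G u v =
     \<lparr> pverts = pverts G - {v},
       parcs = map_prod (id(v := u)) (id(v := u)) ` parcs G - Id \<rparr>"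

inductive induced_minor :: "'a pair_pre_digraph \<Rightarrow> 'a pair_pre_digraph \<Rightarrow> bool"
  for G :: "'a pair_pre_digraph" where
  refl: "induced_minor G G"
| delete: "induced_minor G H \<Longrightarrow> v \<in> pverts H \<Longrightarrow> induced_minor G (delete_vertex H v)"
| contract: "induced_minor G H \<Longrightarrow> (u, v) \<in> parcs H \<Longrightarrow> induced_minor G (contract_edge H u v)"

definition has_induced_minor_iso :: "'a pair_pre_digraph \<Rightarrow> 'b pair_pre_digraph \<Rightarrow> bool" where
  "has_induced_minor_iso G K \<longleftrightarrow> (\<exists>H. induced_minor G H \<and> digraph_iso (with_proj H) (with_proj K))"

subsection \<open>Full binary trees\<close>

text \<open>
  A vertex is encoded by the sequence of left/right choices leading to it from the root \<open>[]\<close>,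
  most recent choice first: the children of \<open>xs\<close> are \<open>False # xs\<close> and \<open>True # xs\<close>.
\<close>

definition bin :: "nat \<Rightarrow> bool list pair_pre_digraph" where
  "bin r =
     (let E = {(xs, b # xs) | xs b. length xs < r}
      in \<lparr> pverts = {xs. length xs \<le> r}, parcs = E \<union> E\<inverse> \<rparr>)"

end

theory Submission
  imports Defs "HOL-Library.Sublist"
begin

text \<open>
  Let \<open>G\<close> have a tree decomposition with bags of size at most \<open>\<tau>\<close>.

  A connected graph of pathwidth at least \<open>k + 3\<tau> + 1\<close> with a prescribed vertex \<open>p\<close> contains a
  star: a connected set \<open>W\<close> through \<open>p\<close> touching two disjoint anticomplete connected sets of
  pathwidth at least \<open>k\<close>. Otherwise, of any two anticomplete sets of large pathwidth one separates
  the other from \<open>p\<close>; this linear structure lets one peel off pieces of pathwidth below \<open>k + \<tau>\<close>,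
  one after the other, along separators of size at most \<open>\<tau>\<close>, which gives a path decomposition.
  Iterating stars yields, when the pathwidth is large, a \<open>d\<close>-ary tree of branch sets in which only
  a node and its ancestors can be adjacent (as in a depth-first search tree).

  In such a tree, colour each leaf by the level of its highest adjacent ancestor. For \<open>d\<close> large
  there is a \<open>d'\<close>-ary subtree of the same height in which all leaves have the same colour \<open>i\<close>.
  If \<open>i\<close> is large, find the binary tree of height \<open>L - 1\<close> with leaves at level \<open>i\<close> and append the
  last level. If \<open>i\<close> is small, pass to the subtree below a node of level \<open>i\<close>: this node is adjacent
  to everything that matters there, and more than \<open>\<tau>\<close> such nodes would produce a
  \<open>K\<^bsub>\<tau>+1,\<tau>+1\<^esub>\<close> minor. The required height thus obeys a Pascal-type recursion and is polynomial
  in \<open>\<tau>\<close> for fixed \<open>L\<close>.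
\<close>

subsection \<open>Connected sets and path decompositions\<close>

text \<open>Nothing controls the edges between a branch set and those far below it, so an induced
  binary tree cannot be read off the tree of branch sets: its nodes must be selected, and the
  selection needs huge arity but only moderate height. The two are paid for very differently.
  Splitting both legs of a star again doubles the number of legs at a cost of
  \<open>3 * t + 1\<close> in pathwidth, so arity \<open>2 ^ M\<close> costs
  \<open>M * (3 * t + 1)\<close> per level, while the height is a plain factor. An arity exponential
  in \<tau> is therefore affordable, but the height must stay polynomial.

  The term \<open>3 * t\<close> comes from peeling: a piece has bags of size at most
  \<open>k + t\<close>, and the separators at its two ends are put into all of its bags; the extra 1
  restores \<open>p\<close>. Separators are small because each lies in the neighbourhood of a
  connected set hanging off a single bag, and this neighbourhood is part of that bag. Treewidth
  enters a second time by limiting how many ancestors can be adjacent to everything below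
  them.\<close>

definition connected_in :: "('a \<times> 'a) set \<Rightarrow> 'a set \<Rightarrow> bool" where
  "connected_in E S \<longleftrightarrow>
     S \<noteq> {} \<and> (\<forall>R. R \<inter> S \<noteq> {} \<longrightarrow> (\<forall>u\<in>R \<inter> S. \<forall>v\<in>S. (u, v) \<in> E \<longrightarrow> v \<in> R) \<longrightarrow> S \<subseteq> R)"

definition touches :: "('a \<times> 'a) set \<Rightarrow> 'a set \<Rightarrow> 'a set \<Rightarrow> bool" where
  "touches E X Y \<longleftrightarrow> (\<exists>x\<in>X. \<exists>y\<in>Y. (x, y) \<in> E)"

definition anticomplete :: "('a \<times> 'a) set \<Rightarrow> 'a set \<Rightarrow> 'a set \<Rightarrow> bool" where
  "anticomplete E X Y \<longleftrightarrow> X \<inter> Y = {} \<and> \<not> touches E X Y"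

text \<open>For \<open>x\<close> outside \<open>S\<close> this degenerates to \<open>{x}\<close>,
  whence the assumption \<open>x \<in> S\<close> in the facts about it.\<close>

definition component :: "('a \<times> 'a) set \<Rightarrow> 'a set \<Rightarrow> 'a \<Rightarrow> 'a set" where
  "component E S x = {y. (x, y) \<in> (E \<inter> S \<times> S)\<^sup>*}"

text \<open>
  Consecutive bags only: a vertex that occurs in a bag and in some later bag must occur in the next
  one, which amounts to every vertex occupying an interval of bags.
\<close>

fun path_bags :: "'a set list \<Rightarrow> bool" where
  "path_bags [] \<longleftrightarrow> True"
| "path_bags (B # Bs) \<longleftrightarrow> (Bs = [] \<or> B \<inter> \<Union>(set Bs) \<subseteq> hd Bs) \<and> path_bags Bs"

definition path_dec :: "('a \<times> 'a) set \<Rightarrow> 'a set \<Rightarrow> nat \<Rightarrow> 'a set list \<Rightarrow> bool" where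
  "path_dec E S k Bs \<longleftrightarrow>
     Bs \<noteq> [] \<and> path_bags Bs \<and> \<Union>(set Bs) = S \<and>
     (\<forall>u\<in>S. \<forall>v\<in>S. (u, v) \<in> E \<longrightarrow> (\<exists>B\<in>set Bs. u \<in> B \<and> v \<in> B)) \<and>
     (\<forall>B\<in>set Bs. finite B \<and> card B \<le> k)"

text \<open>
  The number \<open>k\<close> bounds the bag sizes, so this says pathwidth less than \<open>k\<close>.
\<close>

definition pw_le :: "('a \<times> 'a) set \<Rightarrow> 'a set \<Rightarrow> nat \<Rightarrow> bool" where
  "pw_le E S k \<longleftrightarrow> (\<exists>Bs. path_dec E S k Bs)"

text \<open>
  A tree decomposition of \<open>S\<close> with root bag \<open>X\<close> and bags of size at most \<open>t\<close>, built bottom-up by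
  adding a new root or by merging two trees at their roots. The set \<open>E\<close> may have edges leaving \<open>S\<close>,
  but only from the root bag: this is the purpose of the closure conditions.
\<close>

inductive tree_dec :: "('a \<times> 'a) set \<Rightarrow> nat \<Rightarrow> 'a set \<Rightarrow> 'a set \<Rightarrow> bool"
  for E :: "('a \<times> 'a) set" and t :: nat where
  leaf: "finite X \<Longrightarrow> card X \<le> t \<Longrightarrow> tree_dec E t X X"
| up: "tree_dec E t S Y \<Longrightarrow> finite X \<Longrightarrow> card X \<le> t \<Longrightarrow> X \<inter> S \<subseteq> Y \<Longrightarrow>
    (\<And>u v. u \<in> S - X \<Longrightarrow> (u, v) \<in> E \<Longrightarrow> v \<in> S) \<Longrightarrow> tree_dec E t (S \<union> X) X"
| join: "tree_dec E t S X \<Longrightarrow> tree_dec E t S' X \<Longrightarrow> S \<inter> S' \<subseteq> X \<Longrightarrow>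
    (\<And>u v. u \<in> S - X \<Longrightarrow> (u, v) \<in> E \<Longrightarrow> v \<in> S) \<Longrightarrow>
    (\<And>u v. u \<in> S' - X \<Longrightarrow> (u, v) \<in> E \<Longrightarrow> v \<in> S') \<Longrightarrow> tree_dec E t (S \<union> S') X"

lemma tree_dec_root:
  assumes "tree_dec E t S X"
  shows "X \<subseteq> S" "finite X" "card X \<le> t"
  using assms by (induction) auto

text \<open>The closure form of connectedness serves as an induction principle: a property that
  holds at one vertex and spreads along edges inside \<open>S\<close> holds on all of
  \<open>S\<close>. Connectivity is used in this way instead of through explicit paths.\<close>

lemma connected_in_subset:
  assumes "connected_in E S" "x \<in> S" "x \<in> R"
    and "\<And>u v. u \<in> R \<Longrightarrow> u \<in> S \<Longrightarrow> v \<in> S \<Longrightarrow> (u, v) \<in> E \<Longrightarrow> v \<in> R"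
  shows "S \<subseteq> R"
  using assms unfolding connected_in_def by blast

lemma connected_in_singleton: "connected_in E {x}"
  by (auto simp: connected_in_def)

lemma connected_in_nonempty: "connected_in E S \<Longrightarrow> S \<noteq> {}"
  by (simp add: connected_in_def)

lemma path_bags_map_Un: "path_bags Bs \<Longrightarrow> path_bags (map (\<lambda>B. B \<union> Z) Bs)"
proof (induction Bs)
  case (Cons B Bs)
  then show ?case by (cases Bs) auto
qed simp

lemma path_bags_append:
  assumes "path_bags As" "path_bags Bs" "As \<noteq> []" "Bs \<noteq> []"
    and "\<Union>(set As) \<inter> \<Union>(set Bs) \<subseteq> last As \<inter> hd Bs"
  shows "path_bags (As @ Bs)"
  using assms
proof (induction As)
  case (Cons A As)
  show ?case
  proof (cases "As = []")
    case True
    then show ?thesis using Cons.prems by auto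
  next
    case False
    have "\<Union>(set As) \<inter> \<Union>(set Bs) \<subseteq> last As \<inter> hd Bs"
      using Cons.prems False by auto
    then have "path_bags (As @ Bs)" using Cons False by simp
    moreover have "A \<inter> \<Union>(set (As @ Bs)) \<subseteq> hd As"
    proof
      fix x assume x: "x \<in> A \<inter> \<Union>(set (As @ Bs))"
      show "x \<in> hd As"
      proof (cases "x \<in> \<Union>(set As)")
        case True
        then show ?thesis using x Cons.prems False by auto
      next
        case xn: False
        then have "x \<in> \<Union>(set Bs)" using x by auto
        \<comment> \<open>A vertex of \<open>A\<close> that recurs only in \<open>Bs\<close> lies in
          \<open>last As\<close> by the overlap condition, so it occurs in \<open>As\<close> after
          all.\<close>
        then have "x \<in> last As" using x Cons.prems(5) False by auto
        then show ?thesis using xn False by (auto dest: last_in_set)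
      qed
    qed
    ultimately show ?thesis using False by simp
  qed
qed simp

text \<open>A vertex of the first bag that recurs later is in the second bag, and the induction
  hypothesis carries it on from there. This turns the local condition into the connectedness
  required of a genuine decomposition.\<close>

lemma path_bags_interval:
  assumes "path_bags Bs" "i \<le> j" "j \<le> l" "l < length Bs"
  shows "Bs ! i \<inter> Bs ! l \<subseteq> Bs ! j"
  using assms
proof (induction Bs arbitrary: i j l)
  case (Cons B Bs)
  show ?case
  proof (cases i)
    case (Suc i')
    then obtain j' l' where "j = Suc j'" "l = Suc l'"
      using Cons.prems by (cases j; cases l) auto
    then show ?thesis using Cons Suc by simp
  next
    case 0
    show ?thesis
    proof (cases j)
      case (Suc j')
      then obtain l' where l: "l = Suc l'" using Cons.prems by (cases l) auto
      have ne: "Bs \<noteq> []" using Cons.prems l by auto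
      have "Bs ! l' \<in> set Bs" using Cons.prems l by auto
      then have "Bs ! l' \<subseteq> \<Union>(set Bs)" by blast
      then have "B \<inter> Bs ! l' \<subseteq> Bs ! 0" using Cons.prems ne by (auto simp: hd_conv_nth)
      moreover have "Bs ! 0 \<inter> Bs ! l' \<subseteq> Bs ! j'"
        using Cons.IH[of 0 j' l'] Cons.prems l Suc by auto
      ultimately show ?thesis using 0 Suc l by auto
    qed (use 0 in auto)
  qed
qed simp

lemma path_dec_mono: "path_dec E S k Bs \<Longrightarrow> k \<le> k' \<Longrightarrow> path_dec E S k' Bs"
  unfolding path_dec_def by force

lemma pw_le_mono: "pw_le E S k \<Longrightarrow> k \<le> k' \<Longrightarrow> pw_le E S k'"
  unfolding pw_le_def using path_dec_mono by blast

lemma path_dec_single: "finite X \<Longrightarrow> card X \<le> k \<Longrightarrow> path_dec E X k [X]"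
  by (auto simp: path_dec_def)

lemma path_dec_Un:
  assumes "path_dec E S k Bs" "finite Z" "card Z \<le> j"
  shows "path_dec E (S \<union> Z) (k + j) (map (\<lambda>B. B \<union> Z) Bs)"
proof -
  have 1: "card (B \<union> Z) \<le> k + j" if "B \<in> set Bs" for B
    using card_Un_le[of B Z] that assms unfolding path_dec_def by fastforce
  have 2: "\<exists>B\<in>set Bs. (u \<in> B \<or> u \<in> Z) \<and> (v \<in> B \<or> v \<in> Z)"
    if "u \<in> S \<or> u \<in> Z" "v \<in> S \<or> v \<in> Z" "(u, v) \<in> E" for u v
  proof -
    obtain B where B: "B \<in> set Bs" using assms(1) unfolding path_dec_def by (cases Bs) auto
    have S: "S = \<Union>(set Bs)"
      and e: "u \<in> S \<Longrightarrow> v \<in> S \<Longrightarrow> \<exists>B\<in>set Bs. u \<in> B \<and> v \<in> B"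
      using assms that by (auto simp: path_dec_def)
    show ?thesis using that B e S by (cases "u \<in> S"; cases "v \<in> S") auto
  qed
  show ?thesis
    using assms 1 2 unfolding path_dec_def by (auto simp: path_bags_map_Un)
qed

lemma pw_le_empty: "pw_le E {} k"
  unfolding pw_le_def using path_dec_single[of "{}" k E] by auto

locale sym_edges =
  fixes E :: "('a \<times> 'a) set"
  assumes sym_E: "(u, v) \<in> E \<Longrightarrow> (v, u) \<in> E"
begin

lemma touches_commute: "touches E X Y \<longleftrightarrow> touches E Y X"
  unfolding touches_def using sym_E by blast

lemma anticomplete_commute: "anticomplete E X Y \<longleftrightarrow> anticomplete E Y X"
  unfolding anticomplete_def using touches_commute by blast

lemma connected_in_Un:
  assumes "connected_in E S" "connected_in E S'" "touches E S S' \<or> S \<inter> S' \<noteq> {}"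
  shows "connected_in E (S \<union> S')"
  unfolding connected_in_def
proof (intro conjI allI impI)
  show "S \<union> S' \<noteq> {}" using assms(1) by (auto simp: connected_in_def)
  fix R assume R: "R \<inter> (S \<union> S') \<noteq> {}"
    and cl: "\<forall>u\<in>R \<inter> (S \<union> S'). \<forall>v\<in>S \<union> S'. (u, v) \<in> E \<longrightarrow> v \<in> R"
  have a: "S \<subseteq> R" if "R \<inter> S \<noteq> {}"
    using assms(1) that cl unfolding connected_in_def by blast
  have b: "S' \<subseteq> R" if "R \<inter> S' \<noteq> {}"
    using assms(2) that cl unfolding connected_in_def by blast
  have "S \<subseteq> R \<longleftrightarrow> S' \<subseteq> R"
  proof
    assume "S \<subseteq> R"
    then have "R \<inter> S' \<noteq> {}" using assms(3) cl unfolding touches_def by blast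
    then show "S' \<subseteq> R" by (rule b)
  next
    assume "S' \<subseteq> R"
    moreover have "touches E S' S \<or> S \<inter> S' \<noteq> {}" using assms(3) touches_commute by blast
    ultimately have "R \<inter> S \<noteq> {}" using cl unfolding touches_def by blast
    then show "S \<subseteq> R" by (rule a)
  qed
  then show "S \<union> S' \<subseteq> R" using a b R by blast
qed

lemma component_mem: "x \<in> component E S x"
  by (simp add: component_def)

lemma component_subset: "x \<in> S \<Longrightarrow> component E S x \<subseteq> S"
proof
  fix y assume "x \<in> S" "y \<in> component E S x"
  then have "(x, y) \<in> (E \<inter> S \<times> S)\<^sup>*" by (simp add: component_def)
  then show "y \<in> S" using \<open>x \<in> S\<close> by (induction) auto
qed

lemma component_closed:
  assumes "x \<in> S" "u \<in> component E S x" "v \<in> S" "(u, v) \<in> E"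
  shows "v \<in> component E S x"
proof -
  have "u \<in> S" using component_subset assms by blast
  then have "(u, v) \<in> E \<inter> S \<times> S" using assms by auto
  then show ?thesis
    using assms(2) rtrancl_into_rtrancl[of x u _ v] by (simp add: component_def)
qed

lemma connected_component:
  assumes "x \<in> S"
  shows "connected_in E (component E S x)"
  unfolding connected_in_def
proof (intro conjI allI impI)
  let ?C = "component E S x"
  show "?C \<noteq> {}" using component_mem by blast
  fix R assume "R \<inter> ?C \<noteq> {}" and cl: "\<forall>u\<in>R \<inter> ?C. \<forall>v\<in>?C. (u, v) \<in> E \<longrightarrow> v \<in> R"
  then obtain z where z: "z \<in> R" "z \<in> ?C" by blast
  have "(x, z) \<in> (E \<inter> S \<times> S)\<^sup>*" using z by (simp add: component_def)
  then have "(z, x) \<in> ((E \<inter> S \<times> S)\<inverse>)\<^sup>*" by (rule rtrancl_converseI)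
  moreover have "(E \<inter> S \<times> S)\<inverse> = E \<inter> S \<times> S" using sym_E by blast
  ultimately have zx: "(z, x) \<in> (E \<inter> S \<times> S)\<^sup>*" by simp
  show "?C \<subseteq> R"
  proof
    fix y assume "y \<in> ?C"
    then have "(z, y) \<in> (E \<inter> S \<times> S)\<^sup>*" using zx by (simp add: component_def)
    then have "y \<in> R \<inter> ?C"
    proof (induction)
      case (step u v)
      then have "v \<in> ?C" using component_closed[OF assms] by blast
      then show ?case using step cl by blast
    qed (use z in auto)
    then show "y \<in> R" by blast
  qed
qed

lemma anticomplete_component:
  assumes "x \<in> S"
  shows "anticomplete E (component E S x) (S - component E S x)"
  using component_closed[OF assms] unfolding anticomplete_def touches_def by blast

lemma connected_subset_component:
  assumes "connected_in E D" "D \<subseteq> S" "x \<in> D"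
  shows "D \<subseteq> component E S x"
  by (rule connected_in_subset[OF assms(1,3)])
     (use assms component_mem component_closed[of x S] in blast)+

text \<open>Shared vertices lie in both bags at the seam, and no edge joins the two private parts,
  so each edge is already covered on one side.\<close>

lemma path_dec_append:
  assumes "path_dec E S k As" "path_dec E S' k Bs" "S \<inter> S' \<subseteq> last As \<inter> hd Bs"
    and "\<And>u v. u \<in> S - S' \<Longrightarrow> v \<in> S' - S \<Longrightarrow> (u, v) \<notin> E"
  shows "path_dec E (S \<union> S') k (As @ Bs)"
proof -
  have e: "\<exists>B\<in>set (As @ Bs). u \<in> B \<and> v \<in> B" if "u \<in> S \<union> S'" "v \<in> S \<union> S'" and uv: "(u, v) \<in> E" for u v
  proof -
    have "(u \<in> S \<and> v \<in> S) \<or> (u \<in> S' \<and> v \<in> S')" using assms(4)[of u v] assms(4)[of v u] that sym_E[of u v] by blast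
    then consider (a) "u \<in> S" "v \<in> S" | (b) "u \<in> S'" "v \<in> S'" by blast
    then show ?thesis
    proof cases
      case a
      then obtain B where "B \<in> set As" "u \<in> B" "v \<in> B"
        using assms(1) uv unfolding path_dec_def by blast
      then show ?thesis by auto
    next
      case b
      then obtain B where "B \<in> set Bs" "u \<in> B" "v \<in> B"
        using assms(2) uv unfolding path_dec_def by blast
      then show ?thesis by auto
    qed
  qed
  then show ?thesis
    using assms(1-3) path_bags_append[of As Bs] unfolding path_dec_def by auto
qed

lemma pw_le_Un_anticomplete:
  assumes "pw_le E S k" "pw_le E S' k" "anticomplete E S S'"
  shows "pw_le E (S \<union> S') k"
  using assms path_dec_append[of S k _ S'] unfolding pw_le_def anticomplete_def touches_def by blast

text \<open>Decompositions of mutually anticomplete parts can be concatenated. Peeling off one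
  component \<open>D\<close> leaves a set whose components are still components of
  \<open>S\<close>.\<close>

lemma pw_le_components:
  assumes "finite S"
    and "\<And>D. D \<subseteq> S \<Longrightarrow> connected_in E D \<Longrightarrow> anticomplete E D (S - D) \<Longrightarrow> pw_le E D k"
  shows "pw_le E S k"
  using assms
proof (induction "card S" arbitrary: S rule: less_induct)
  case less
  show ?case
  proof (cases "S = {}")
    case False
    then obtain x where x: "x \<in> S" by blast
    define D where "D = component E S x"
    have D: "D \<subseteq> S" "connected_in E D" "anticomplete E D (S - D)" "x \<in> D"
      unfolding D_def using component_subset[OF x] connected_component[OF x]
        anticomplete_component[OF x] component_mem[of x S] by auto
    have "pw_le E (S - D) k"
    proof (rule less.hyps)
      show "card (S - D) < card S"
        using D x less.prems by (intro psubset_card_mono) auto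
      fix D' assume D': "D' \<subseteq> S - D" "connected_in E D'" "anticomplete E D' (S - D - D')"
      have "anticomplete E D' (S - D')"
      proof -
        have "(x, y) \<notin> E" if "x \<in> D'" "y \<in> D" for x y
          using D(3) D'(1) that sym_E[of x y] unfolding anticomplete_def touches_def by blast
        moreover have "(x, y) \<notin> E" if "x \<in> D'" "y \<in> S - D" "y \<notin> D'" for x y
          using D'(3) that unfolding anticomplete_def touches_def by blast
        ultimately show ?thesis unfolding anticomplete_def touches_def by blast
      qed
      moreover have "D' \<subseteq> S" using D' by blast
      ultimately show "pw_le E D' k" using D'(2) by (intro less.prems(2))
    qed (use less.prems in simp)
    then have "pw_le E (D \<union> (S - D)) k"
      using pw_le_Un_anticomplete D less.prems by blast
    moreover have "D \<union> (S - D) = S" using D by blast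
    ultimately show ?thesis by simp
  qed (simp add: pw_le_empty)
qed

lemma big_component:
  assumes "finite S" "\<not> pw_le E S k"
  obtains D where "D \<subseteq> S" "connected_in E D" "anticomplete E D (S - D)" "\<not> pw_le E D k"
  using pw_le_components assms by blast

section \<open>Two separated sets of large pathwidth with small neighbourhoods\<close>

definition nbrs :: "'a set \<Rightarrow> 'a set" where
  "nbrs D = {v. v \<notin> D \<and> (\<exists>u\<in>D. (u, v) \<in> E)}"

text \<open>The two sets arise as components of what hangs off a bag, with the bag removed. The
  bounds on their neighbourhoods are kept because these neighbourhoods later contain the
  separators.\<close>

definition cone_pair :: "'a set \<Rightarrow> nat \<Rightarrow> nat \<Rightarrow> 'a set \<Rightarrow> bool" where
  "cone_pair C t k Z \<longleftrightarrow>
     (\<exists>D1 D2. D1 \<subseteq> Z \<and> D2 \<subseteq> Z \<and> connected_in E D1 \<and> connected_in E D2 \<and>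
        anticomplete E D1 D2 \<and> \<not> pw_le E D1 k \<and> \<not> pw_le E D2 k \<and>
        card (nbrs D1 \<inter> C) \<le> t \<and> card (nbrs D2 \<inter> C) \<le> t)"

lemma cone_pair_mono: "cone_pair C t k Z \<Longrightarrow> Z \<subseteq> Z' \<Longrightarrow> cone_pair C t k Z'"
  unfolding cone_pair_def by blast

text \<open>
  If two subtrees hanging off a common root bag both contain a set of large pathwidth, these form the
  pair. Otherwise such sets occur along a single branch, and the bags of this branch form the spine
  of a path decomposition.
\<close>

lemma cone_pair_or_path_dec:
  assumes "tree_dec E t S X" "finite C"
  shows "cone_pair C t k (C \<inter> S - X) \<or>
         (\<exists>Bs. path_dec E (C \<inter> S) (k + t) Bs \<and> C \<inter> X \<subseteq> hd Bs)"
    (is "?pair S X \<or> ?dec S X")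
  using assms(1)
proof (induction)
  case (leaf X)
  have "card (C \<inter> X) \<le> t" using leaf card_mono[of X "C \<inter> X"] by auto
  then have "path_dec E (C \<inter> X) (k + t) [C \<inter> X]" using leaf by (intro path_dec_single) auto
  then show ?case by (intro disjI2 exI[of _ "[C \<inter> X]"]) auto
next
  case (up S Y X)
  from up.IH show ?case
  proof
    assume "?pair S Y"
    moreover have "C \<inter> S - Y \<subseteq> C \<inter> (S \<union> X) - X" using up by blast
    ultimately show ?thesis using cone_pair_mono by blast
  next
    assume "?dec S Y"
    then obtain Bs where Bs: "path_dec E (C \<inter> S) (k + t) Bs" "C \<inter> Y \<subseteq> hd Bs" by blast
    have "card (C \<inter> X) \<le> t" using up card_mono[of X "C \<inter> X"] by auto
    then have "path_dec E (C \<inter> X) (k + t) [C \<inter> X]" using up by (intro path_dec_single) auto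
    then have "path_dec E (C \<inter> X \<union> C \<inter> S) (k + t) ([C \<inter> X] @ Bs)"
      using Bs(1)
    proof (rule path_dec_append)
      show "C \<inter> X \<inter> (C \<inter> S) \<subseteq> last [C \<inter> X] \<inter> hd Bs" using up Bs by auto
      fix u v assume "u \<in> C \<inter> X - C \<inter> S" "v \<in> C \<inter> S - C \<inter> X"
      then show "(u, v) \<notin> E" using up(5)[of v u] sym_E by blast
    qed
    moreover have "C \<inter> X \<union> C \<inter> S = C \<inter> (S \<union> X)" by blast
    ultimately show ?thesis by (intro disjI2 exI[of _ "[C \<inter> X] @ Bs"]) auto
  qed
next
  case (join S X S')
  have X: "finite X" "card X \<le> t" using tree_dec_root[OF join(1)] by auto
  then have cX: "card (C \<inter> X) \<le> t" using card_mono[of X "C \<inter> X"] by auto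
  have sub: "X \<subseteq> S" "X \<subseteq> S'" using tree_dec_root[OF join(1)] tree_dec_root[OF join(2)] by auto
  \<comment> \<open>Away from \<open>X\<close> no edge leaves \<open>U\<close>, so a neighbour of
    the component \<open>D\<close> in \<open>C\<close> stays in \<open>U\<close>; not belonging to
    the component, it must lie in the bag \<open>X\<close>. This is the origin of the bound
    \<open>t\<close>.\<close>
  have cone: "\<exists>D. D \<subseteq> C \<inter> U - X \<and> connected_in E D \<and> \<not> pw_le E D k \<and>
      card (nbrs D \<inter> C) \<le> t \<and> nbrs D \<subseteq> U"
    if big: "\<not> pw_le E (C \<inter> U - X) k" and U: "\<And>u v. u \<in> U - X \<Longrightarrow> (u, v) \<in> E \<Longrightarrow> v \<in> U" for U
  proof -
    obtain D where D: "D \<subseteq> C \<inter> U - X" "connected_in E D" "anticomplete E D (C \<inter> U - X - D)"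
        "\<not> pw_le E D k"
      using big_component[OF _ big] assms(2) by blast
    have "D \<subseteq> U - X" using D(1) by blast
    then have n: "nbrs D \<subseteq> U" unfolding nbrs_def using U by blast
    have "nbrs D \<inter> C \<subseteq> X"
    proof
      fix v assume v: "v \<in> nbrs D \<inter> C"
      then obtain u where "u \<in> D" "(u, v) \<in> E" "v \<notin> D" by (auto simp: nbrs_def)
      then show "v \<in> X" using v n D(3) unfolding anticomplete_def touches_def by auto
    qed
    then have "card (nbrs D \<inter> C) \<le> t" using X card_mono[of X "nbrs D \<inter> C"] by auto
    then show ?thesis using D n by blast
  qed
  have small: "\<exists>As. path_dec E (C \<inter> U) (k + t) As \<and> C \<inter> X \<subseteq> hd As \<and> C \<inter> X \<subseteq> last As"
    if pw: "pw_le E (C \<inter> U - X) k" and XU: "X \<subseteq> U" for U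
  proof -
    obtain As where As: "path_dec E (C \<inter> U - X) k As" using pw by (auto simp: pw_le_def)
    have "path_dec E ((C \<inter> U - X) \<union> (C \<inter> X)) (k + t) (map (\<lambda>B. B \<union> C \<inter> X) As)"
      using As cX assms(2) by (intro path_dec_Un) auto
    moreover have "(C \<inter> U - X) \<union> (C \<inter> X) = C \<inter> U" using XU by blast
    moreover have "As \<noteq> []" using As by (simp add: path_dec_def)
    ultimately show ?thesis
      by (intro exI[of _ "map (\<lambda>B. B \<union> C \<inter> X) As"]) (auto simp: hd_map last_map)
  qed
  \<comment> \<open>The side of small pathwidth gets the root bag added to all of its bags, so it
    begins and ends with \<open>C \<inter> X\<close> and can be placed in front of the other side
    without losing the condition on the first bag.\<close>
  have app: "\<exists>Bs. path_dec E (C \<inter> (U \<union> U')) (k + t) Bs \<and> C \<inter> X \<subseteq> hd Bs"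
    if pw: "pw_le E (C \<inter> U - X) k" "X \<subseteq> U" "?dec U' X" and UU: "U \<inter> U' \<subseteq> X"
      and U: "\<And>u v. u \<in> U - X \<Longrightarrow> (u, v) \<in> E \<Longrightarrow> v \<in> U" and XU': "X \<subseteq> U'" for U U'
  proof -
    obtain As where As: "path_dec E (C \<inter> U) (k + t) As" "C \<inter> X \<subseteq> hd As" "C \<inter> X \<subseteq> last As"
      using small[OF pw(1,2)] by blast
    obtain Bs where Bs: "path_dec E (C \<inter> U') (k + t) Bs" "C \<inter> X \<subseteq> hd Bs" using pw(3) by blast
    have "path_dec E (C \<inter> U \<union> C \<inter> U') (k + t) (As @ Bs)"
      using As(1) Bs(1)
    proof (rule path_dec_append)
      show "C \<inter> U \<inter> (C \<inter> U') \<subseteq> last As \<inter> hd Bs" using UU As Bs by blast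
      fix u v assume "u \<in> C \<inter> U - C \<inter> U'" "v \<in> C \<inter> U' - C \<inter> U"
      then show "(u, v) \<notin> E" using U[of u v] XU' by blast
    qed
    moreover have "As \<noteq> []" using As by (simp add: path_dec_def)
    ultimately show ?thesis using As by (intro exI[of _ "As @ Bs"]) (auto simp: Int_Un_distrib)
  qed
  consider (a) "?pair S X" | (b) "?pair S' X" | (c) "?dec S X" "?dec S' X" using join.IH by blast
  then show ?case
  proof cases
    case a
    moreover have "C \<inter> S - X \<subseteq> C \<inter> (S \<union> S') - X" by blast
    ultimately show ?thesis using cone_pair_mono by blast
  next
    case b
    moreover have "C \<inter> S' - X \<subseteq> C \<inter> (S \<union> S') - X" by blast
    ultimately show ?thesis using cone_pair_mono by blast
  next
    case c
    show ?thesis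
    proof (cases "pw_le E (C \<inter> S - X) k")
      case True
      have "?dec (S \<union> S') X"
        by (rule app[OF True sub(1) c(2) join.hyps(3) _ sub(2)]) (rule join.hyps(4))
      then show ?thesis ..
    next
      case nS: False
      show ?thesis
      proof (cases "pw_le E (C \<inter> S' - X) k")
        case True
        have "S' \<inter> S \<subseteq> X" using join by blast
        then have "?dec (S' \<union> S) X"
          by (rule app[OF True sub(2) c(1) _ _ sub(1)]) (rule join.hyps(5))
        then show ?thesis by (simp add: Un_commute)
      next
        case False
        obtain D1 where D1: "D1 \<subseteq> C \<inter> S - X" "connected_in E D1" "\<not> pw_le E D1 k"
            "card (nbrs D1 \<inter> C) \<le> t" "nbrs D1 \<subseteq> S"
          using cone[OF nS] join.hyps(4) by blast
        obtain D2 where D2: "D2 \<subseteq> C \<inter> S' - X" "connected_in E D2" "\<not> pw_le E D2 k"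
            "card (nbrs D2 \<inter> C) \<le> t" "nbrs D2 \<subseteq> S'"
          using cone[OF False] join.hyps(5) by blast
        have "anticomplete E D1 D2"
          using D1 D2 join(3) unfolding anticomplete_def touches_def nbrs_def by blast
        moreover have "D1 \<subseteq> C \<inter> (S \<union> S') - X" "D2 \<subseteq> C \<inter> (S \<union> S') - X" using D1(1) D2(1) by blast+
        ultimately have "?pair (S \<union> S') X" using D1 D2 unfolding cone_pair_def by blast
        then show ?thesis ..
      qed
    qed
  qed
qed

lemma two_cones:
  assumes "tree_dec E t V X" "finite V" "K \<subseteq> V" "\<not> pw_le E K (k + t)"
  obtains D1 D2 where "D1 \<subseteq> K" "D2 \<subseteq> K" "connected_in E D1" "connected_in E D2"
    "anticomplete E D1 D2" "\<not> pw_le E D1 k" "\<not> pw_le E D2 k"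
    "card (nbrs D1 \<inter> K) \<le> t" "card (nbrs D2 \<inter> K) \<le> t"
proof -
  have "finite K" "K \<inter> V = K" using assms finite_subset by auto
  then have "cone_pair K t k (K - X)"
    using cone_pair_or_path_dec[OF assms(1), of K k] assms(4) unfolding pw_le_def by auto
  then have "cone_pair K t k K" using cone_pair_mono by blast
  then show ?thesis using that unfolding cone_pair_def by blast
qed

end

subsection \<open>Stars in graphs of large pathwidth\<close>

context sym_edges
begin

definition star :: "'a set \<Rightarrow> 'a \<Rightarrow> nat \<Rightarrow> bool" where
  "star C p k \<longleftrightarrow>
     (\<exists>W D1 D2. W \<subseteq> C \<and> D1 \<subseteq> C \<and> D2 \<subseteq> C \<and> p \<in> W \<and>
        connected_in E W \<and> connected_in E D1 \<and> connected_in E D2 \<and>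
        W \<inter> D1 = {} \<and> W \<inter> D2 = {} \<and> anticomplete E D1 D2 \<and>
        touches E W D1 \<and> touches E W D2 \<and> \<not> pw_le E D1 k \<and> \<not> pw_le E D2 k)"

text \<open>
  \<open>D1\<close> separates \<open>A\<close> from \<open>D2\<close> in \<open>C\<close>; the witness \<open>R\<close> is a union of components of \<open>C - D1\<close>.
\<close>

definition shields :: "'a set \<Rightarrow> 'a set \<Rightarrow> 'a set \<Rightarrow> 'a set \<Rightarrow> bool" where
  "shields C A D1 D2 \<longleftrightarrow>
     (\<exists>R. A \<subseteq> R \<and> R \<subseteq> C \<and> R \<inter> D1 = {} \<and> R \<inter> D2 = {} \<and>
        (\<forall>u\<in>R. \<forall>v\<in>C. (u, v) \<in> E \<longrightarrow> v \<in> R \<union> D1))"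

text \<open>Take the component of \<open>p\<close> in \<open>C - D1 - D2\<close>. If it touches both
  sets it is the centre of a star; otherwise it can be left through only one of them, and that one
  shields the other.\<close>

lemma shields_dichotomy:
  assumes "\<not> star C p k" "connected_in E A" "p \<in> A" "A \<subseteq> C"
    and D: "D1 \<subseteq> C - A" "D2 \<subseteq> C - A" "connected_in E D1" "connected_in E D2"
      "anticomplete E D1 D2" "\<not> pw_le E D1 k" "\<not> pw_le E D2 k"
  shows "shields C A D1 D2 \<or> shields C A D2 D1"
proof -
  let ?S = "C - D1 - D2"
  define R where "R = component E ?S p"
  have p: "p \<in> ?S" using assms(3,4) D(1,2) by blast
  have R: "R \<subseteq> ?S" "connected_in E R" "p \<in> R"
    unfolding R_def using component_subset[OF p] connected_component[OF p] component_mem by auto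
  have AR: "A \<subseteq> R"
    unfolding R_def by (rule connected_subset_component) (use assms D in auto)
  have cl: "v \<in> R \<union> D1 \<union> D2" if "u \<in> R" "v \<in> C" "(u, v) \<in> E" for u v
    using component_closed[OF p, of u v] that unfolding R_def by blast
  have "\<not> (touches E R D1 \<and> touches E R D2)"
  proof
    assume "touches E R D1 \<and> touches E R D2"
    then have "star C p k"
      unfolding star_def using R D by (intro exI[of _ R] exI[of _ D1] exI[of _ D2]) auto
    then show False using assms by blast
  qed
  then show ?thesis
  proof (cases "touches E R D2")
    case False
    then have "\<forall>u\<in>R. \<forall>v\<in>C. (u, v) \<in> E \<longrightarrow> v \<in> R \<union> D1"
      using cl unfolding touches_def by blast
    then have "shields C A D1 D2"
      unfolding shields_def using R AR by (intro exI[of _ R]) auto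
    then show ?thesis ..
  next
    case True
    then have "\<not> touches E R D1" using \<open>\<not> (touches E R D1 \<and> touches E R D2)\<close> by blast
    then have "\<forall>u\<in>R. \<forall>v\<in>C. (u, v) \<in> E \<longrightarrow> v \<in> R \<union> D2"
      using cl unfolding touches_def by blast
    then have "shields C A D2 D1"
      unfolding shields_def using R AR by (intro exI[of _ R]) auto
    then show ?thesis ..
  qed
qed

text \<open>\<open>Y\<close> is the component of \<open>C - D1\<close> that contains
  \<open>D2\<close>. It misses the shield's witness \<open>R\<close>, since meeting it would force
  \<open>Y \<subseteq> R\<close> and hence \<open>D2\<close> to meet \<open>R\<close>. What remains
  of \<open>C\<close> is connected because all other components of \<open>C - D1\<close> hang on the
  connected set \<open>D1\<close>.\<close>

lemma shields_cut:
  assumes "connected_in E C" "connected_in E D1" "connected_in E D2" "D1 \<subseteq> C" "D2 \<subseteq> C"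
    and "anticomplete E D1 D2" "shields C A D1 D2"
  obtains Y where "D2 \<subseteq> Y" "Y \<subseteq> C - D1" "connected_in E Y" "A \<inter> Y = {}" "connected_in E (C - Y)"
    "\<And>u v. u \<in> C - Y \<Longrightarrow> v \<in> Y \<Longrightarrow> (u, v) \<in> E \<Longrightarrow> u \<in> D1"
proof -
  obtain y where y: "y \<in> D2" using assms(3) connected_in_nonempty by blast
  have yS: "y \<in> C - D1" using y assms by (auto simp: anticomplete_def)
  define Y where "Y = component E (C - D1) y"
  have Y: "Y \<subseteq> C - D1" "connected_in E Y" "y \<in> Y"
    unfolding Y_def using component_subset[OF yS] connected_component[OF yS] component_mem by auto
  have D2Y: "D2 \<subseteq> Y"
    unfolding Y_def by (rule connected_subset_component) (use assms y in \<open>auto simp: anticomplete_def\<close>)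
  have bd: "u \<in> D1" if "u \<in> C - Y" "v \<in> Y" "(u, v) \<in> E" for u v
    using component_closed[OF yS, of v u] that sym_E[of u v] unfolding Y_def by blast
  obtain R where R: "A \<subseteq> R" "R \<subseteq> C" "R \<inter> D1 = {}" "R \<inter> D2 = {}"
      "\<And>u v. u \<in> R \<Longrightarrow> v \<in> C \<Longrightarrow> (u, v) \<in> E \<Longrightarrow> v \<in> R \<union> D1"
    using assms(7) unfolding shields_def by blast
  have "R \<inter> Y = {}"
  proof (rule ccontr)
    assume "R \<inter> Y \<noteq> {}"
    then obtain z where "z \<in> Y" "z \<in> R" by blast
    then have "Y \<subseteq> R"
      by (rule connected_in_subset[OF Y(2)]) (use R(5) Y(1) in blast)
    then show False using R(4) D2Y y by blast
  qed
  then have AY: "A \<inter> Y = {}" using R(1) by blast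
  have "connected_in E (C - Y)"
    unfolding connected_in_def
  proof (intro conjI allI impI)
    obtain d where d: "d \<in> D1" using assms(2) connected_in_nonempty by blast
    have D1: "D1 \<subseteq> C - Y" using Y(1) assms(4) by blast
    show "C - Y \<noteq> {}" using d D1 by blast
    fix Q assume ne: "Q \<inter> (C - Y) \<noteq> {}"
      and cl: "\<forall>u\<in>Q \<inter> (C - Y). \<forall>v\<in>C - Y. (u, v) \<in> E \<longrightarrow> v \<in> Q"
    \<comment> \<open>Edges into \<open>Y\<close> start in \<open>D1\<close>, so a closed part of
      \<open>C - Y\<close> missing \<open>D1\<close> would be closed in all of \<open>C\<close>.
      Once \<open>Q\<close> contains \<open>D1\<close>, the same reasoning applies to the part of
      \<open>C - Y\<close> outside \<open>Q\<close>.\<close>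
    have "Q \<inter> D1 \<noteq> {}"
    proof
      assume QD: "Q \<inter> D1 = {}"
      obtain q where q: "q \<in> Q" "q \<in> C" "q \<notin> Y" using ne by blast
      have "C \<subseteq> Q \<inter> (C - Y)"
        by (rule connected_in_subset[OF assms(1), of q]) (use q bd QD cl in blast)+
      then show False using d QD assms(4) by blast
    qed
    then obtain d' where "d' \<in> D1" "d' \<in> Q" by blast
    then have DQ: "D1 \<subseteq> Q"
      by (rule connected_in_subset[OF assms(2)]) (use D1 cl in blast)
    show "C - Y \<subseteq> Q"
    proof (rule ccontr)
      assume "\<not> C - Y \<subseteq> Q"
      then obtain z where z: "z \<in> C" "z \<notin> Y" "z \<notin> Q" by blast
      have "C \<subseteq> (C - Y) - Q"
      proof (rule connected_in_subset[OF assms(1), of z])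
        fix u v assume uv: "u \<in> C - Y - Q" "u \<in> C" "v \<in> C" "(u, v) \<in> E"
        then have "v \<notin> Y" using bd[of u v] DQ by blast
        moreover have "v \<notin> Q" using uv cl sym_E[of u v] calculation by blast
        ultimately show "v \<in> C - Y - Q" using uv by blast
      qed (use z in auto)
      then show False using d D1 DQ by blast
    qed
  qed
  then show ?thesis using that D2Y Y AY bd by blast
qed

end

section \<open>Peeling along small separators\<close>

locale bounded_tree_dec = sym_edges +
  fixes V X :: "'a set" and t :: nat
  assumes tree_dec: "tree_dec E t V X" and finite_V: "finite V"
begin

text \<open>\<open>A'\<close> is an initial portion of \<open>C\<close> as seen from
  \<open>A\<close>. The set \<open>b\<close> records that something of large pathwidth remains
  beyond it; it fixes the direction in which later cones inside \<open>A'\<close> must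
  shield.\<close>

definition cut_off :: "'a set \<Rightarrow> nat \<Rightarrow> 'a set \<Rightarrow> 'a set \<Rightarrow> bool" where
  "cut_off C k A A' \<longleftrightarrow>
     A \<subset> A' \<and> A' \<subseteq> C \<and> connected_in E A' \<and> connected_in E (C - A') \<and>
     card (nbrs A' \<inter> C) \<le> t \<and>
     (\<exists>b. connected_in E b \<and> b \<subseteq> C - A' \<and> \<not> pw_le E b k \<and> \<not> touches E A' b)"

text \<open>One of two cones in \<open>C - A\<close> shields \<open>A\<close> from the other; cut
  off the side \<open>Y\<close> of the shielded one. Since \<open>Y\<close> avoids \<open>A\<close>,
  the vertices of \<open>Y\<close> adjacent to the rest are neighbours of the shielding cone inside
  \<open>C - A\<close>, at most \<open>t\<close> in number. The shielded cone itself serves as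
  \<open>b\<close>.\<close>

lemma cut_off_exists:
  assumes "\<not> star C p k" "C \<subseteq> V" "connected_in E C" "connected_in E A" "p \<in> A" "A \<subseteq> C"
    and "\<not> pw_le E (C - A) (k + t)"
  shows "\<exists>A'. cut_off C k A A'"
proof -
  have fC: "finite C" using assms finite_V finite_subset by blast
  obtain D1 D2 where D: "D1 \<subseteq> C - A" "D2 \<subseteq> C - A" "connected_in E D1" "connected_in E D2"
    "anticomplete E D1 D2" "\<not> pw_le E D1 k" "\<not> pw_le E D2 k"
    "card (nbrs D1 \<inter> (C - A)) \<le> t" "card (nbrs D2 \<inter> (C - A)) \<le> t"
    using two_cones[OF tree_dec finite_V _ assms(7)] assms(2) by blast
  have *: "\<exists>A'. cut_off C k A A'"
    if D: "D1 \<subseteq> C - A" "D2 \<subseteq> C - A" "connected_in E D1" "connected_in E D2"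
    "anticomplete E D1 D2" "\<not> pw_le E D2 k" "card (nbrs D1 \<inter> (C - A)) \<le> t"
    and sh: "shields C A D1 D2" for D1 D2
  proof -
    obtain Y where Y: "D2 \<subseteq> Y" "Y \<subseteq> C - D1" "connected_in E Y" "A \<inter> Y = {}" "connected_in E (C - Y)"
      "\<And>u v. u \<in> C - Y \<Longrightarrow> v \<in> Y \<Longrightarrow> (u, v) \<in> E \<Longrightarrow> u \<in> D1"
      using shields_cut[OF assms(3) D(3,4) _ _ D(5) sh] D(1,2) by blast
    have CY: "C - (C - Y) = Y" using Y by blast
    have "nbrs (C - Y) \<inter> C \<subseteq> nbrs D1 \<inter> (C - A)"
      unfolding nbrs_def using Y by blast
    then have c: "card (nbrs (C - Y) \<inter> C) \<le> t"
      using D(7) card_mono[of "nbrs D1 \<inter> (C - A)" "nbrs (C - Y) \<inter> C"] fC by force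
    have nt: "\<not> touches E (C - Y) D2"
      using Y(1,6) D(5) unfolding touches_def anticomplete_def by blast
    obtain d where "d \<in> D1" using D(3) connected_in_nonempty by blast
    then have "A \<subset> C - Y" using Y assms(6) D(1) by blast
    then have "cut_off C k A (C - Y)"
      unfolding cut_off_def CY using Y c nt D(4,6) by blast
    then show ?thesis by blast
  qed
  have "shields C A D1 D2 \<or> shields C A D2 D1"
    using shields_dichotomy[OF assms(1,4,5,6)] D by blast
  moreover have "anticomplete E D2 D1" using D anticomplete_commute by blast
  ultimately show ?thesis using *[of D1 D2] *[of D2 D1] D by blast
qed

text \<open>
  Two cones inside \<open>A' - A\<close> are comparable with each other and with the large set \<open>b\<close> beyond \<open>A'\<close>, so
  cutting along the first of them gives a smaller cut, again with a separator inside a single bag.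
\<close>

lemma cut_off_shrink:
  assumes "\<not> star C p k" "C \<subseteq> V" "connected_in E C" "connected_in E A" "p \<in> A" "A \<subseteq> C"
    and cut: "cut_off C k A A'" and big: "\<not> pw_le E (A' - A) (k + t)"
  shows "\<exists>A''. A'' \<subset> A' \<and> cut_off C k A A''"
proof -
  have fC: "finite C" using assms finite_V finite_subset by blast
  obtain b where A': "A \<subset> A'" "A' \<subseteq> C" "connected_in E A'" "connected_in E (C - A')"
    and b: "connected_in E b" "b \<subseteq> C - A'" "\<not> pw_le E b k" "\<not> touches E A' b"
    using cut unfolding cut_off_def by blast
  obtain b0 where b0: "b0 \<in> b" using b(1) connected_in_nonempty by blast
  obtain D1 D2 where D: "D1 \<subseteq> A' - A" "D2 \<subseteq> A' - A" "connected_in E D1" "connected_in E D2"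
    "anticomplete E D1 D2" "\<not> pw_le E D1 k" "\<not> pw_le E D2 k"
    "card (nbrs D1 \<inter> (A' - A)) \<le> t" "card (nbrs D2 \<inter> (A' - A)) \<le> t"
    using two_cones[OF tree_dec finite_V _ big] assms(2) A'(2) by blast
  have shb: "shields C A D b"
    if D: "D \<subseteq> A' - A" "connected_in E D" "\<not> pw_le E D k" for D
  proof -
    have ac: "anticomplete E D b"
      using D(1) b(2,4) unfolding anticomplete_def touches_def by blast
    have "shields C A D b \<or> shields C A b D"
    proof (rule shields_dichotomy[OF assms(1,4,5,6)])
      show "D \<subseteq> C - A" "b \<subseteq> C - A" using D(1) b(2) A'(1,2) by blast+
    qed (use D b ac in auto)
    \<comment> \<open>If \<open>b\<close> were the shield, then \<open>R\<close> would be closed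
      inside the connected set \<open>A'\<close>, which is disjoint from \<open>b\<close>; so
      \<open>R\<close> would contain \<open>A'\<close> and with it \<open>D\<close>.\<close>
    moreover have "\<not> shields C A b D"
    proof
      assume "shields C A b D"
      then obtain R where R: "A \<subseteq> R" "R \<subseteq> C" "R \<inter> b = {}" "R \<inter> D = {}"
        "\<And>u v. u \<in> R \<Longrightarrow> v \<in> C \<Longrightarrow> (u, v) \<in> E \<Longrightarrow> v \<in> R \<union> b"
        unfolding shields_def by blast
      have "A' \<subseteq> R"
        by (rule connected_in_subset[OF A'(3), of p]) (use R assms(5) A' b(2) in blast)+
      then show False using R(4) D connected_in_nonempty by blast
    qed
    ultimately show ?thesis by blast
  qed
  have *: "\<exists>A''. A'' \<subset> A' \<and> cut_off C k A A''"
    if D: "D1 \<subseteq> A' - A" "D2 \<subseteq> A' - A" "connected_in E D1" "connected_in E D2"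
    "anticomplete E D1 D2" "\<not> pw_le E D2 k" "card (nbrs D1 \<inter> (A' - A)) \<le> t"
    and sh: "shields C A D1 D2" for D1 D2
  proof -
    have DC: "D1 \<subseteq> C" "D2 \<subseteq> C" using D(1,2) A' by blast+
    obtain Y where Y: "D2 \<subseteq> Y" "Y \<subseteq> C - D1" "connected_in E Y" "A \<inter> Y = {}" "connected_in E (C - Y)"
      "\<And>u v. u \<in> C - Y \<Longrightarrow> v \<in> Y \<Longrightarrow> (u, v) \<in> E \<Longrightarrow> u \<in> D1"
      using shields_cut[OF assms(3) D(3,4) DC D(5) sh] by blast
    have CY: "C - (C - Y) = Y" using Y by blast
    obtain d1 where d1: "d1 \<in> D1" using D(3) connected_in_nonempty by blast
    obtain d2 where d2: "d2 \<in> D2" using D(4) connected_in_nonempty by blast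
    obtain R where R: "A \<subseteq> R" "R \<subseteq> C" "R \<inter> D2 = {}" "R \<inter> b = {}"
      "\<And>u v. u \<in> R \<Longrightarrow> v \<in> C \<Longrightarrow> (u, v) \<in> E \<Longrightarrow> v \<in> R \<union> D2"
      using shb[OF D(2,4,6)] unfolding shields_def by blast
    \<comment> \<open>\<open>D2\<close> separates \<open>A\<close> from \<open>b\<close>: a
      connected set through \<open>p\<close> that avoids \<open>D2\<close> stays in \<open>R\<close>
      and never meets \<open>b\<close>.\<close>
    have in_R: "Q \<subseteq> R" if "connected_in E Q" "p \<in> Q" "Q \<subseteq> C" "Q \<inter> D2 = {}" for Q
      by (rule connected_in_subset[OF that(1,2)]) (use R that assms(5) in blast)+
    have pY: "p \<in> C - Y" using assms(5,6) Y(4) by blast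
    have YR: "C - Y \<subseteq> R"
      by (rule in_R) (use Y pY in blast)+
    then have b0Y: "b0 \<in> Y" using b0 R(4) b(2) by blast
    have rest: "C - A' \<subseteq> Y"
    proof (rule connected_in_subset[OF A'(4), of b0])
      fix u v assume uv: "u \<in> Y" "u \<in> C - A'" "v \<in> C - A'" "(u, v) \<in> E"
      show "v \<in> Y"
      proof (rule ccontr)
        assume "v \<notin> Y"
        then have "v \<in> D1" using Y(6)[of v u] uv sym_E[of u v] by blast
        then show False using uv D(1) by blast
      qed
    qed (use b0 b b0Y in blast)+
    have bY: "b \<subseteq> Y" using rest b by blast
    have "nbrs (C - Y) \<inter> C \<subseteq> nbrs D1 \<inter> (A' - A)"
    proof
      fix v assume "v \<in> nbrs (C - Y) \<inter> C"
      then obtain u where u: "u \<in> C - Y" "(u, v) \<in> E" "v \<in> Y" "v \<in> C" by (auto simp: nbrs_def)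
      then have uD: "u \<in> D1" using Y(6) by blast
      \<comment> \<open>The cone's neighbourhood is bounded only within \<open>A' - A\<close>. If
        the cut had an edge leaving \<open>A'\<close>, then \<open>C - Y\<close> together with the
        connected set \<open>C - A'\<close> would lead from \<open>p\<close> to \<open>b\<close>
        avoiding \<open>D2\<close>.\<close>
      have "v \<in> A'"
      proof (rule ccontr)
        assume vA: "v \<notin> A'"
        have "touches E (C - Y) (C - A')" using u vA unfolding touches_def by blast
        then have "connected_in E ((C - Y) \<union> (C - A'))"
          using connected_in_Un[OF Y(5) A'(4)] by blast
        then have "(C - Y) \<union> (C - A') \<subseteq> R"
          by (rule in_R) (use pY D(2) Y(1) in blast)+
        then show False using b0 b(2) R(4) by blast
      qed
      then show "v \<in> nbrs D1 \<inter> (A' - A)"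
        using u(2,3) uD Y(2,4) unfolding nbrs_def by blast
    qed
    then have c: "card (nbrs (C - Y) \<inter> C) \<le> t"
      using D(7) card_mono[of "nbrs D1 \<inter> (A' - A)" "nbrs (C - Y) \<inter> C"] fC A'(2)
        finite_subset[of "A' - A" C] by force
    have nt: "\<not> touches E (C - Y) b"
      using Y(6) D(1) b(4) bY unfolding touches_def by blast
    have "A \<subset> C - Y" using Y assms(6) D(1) d1 DC by blast
    then have "cut_off C k A (C - Y)"
      unfolding cut_off_def CY using Y c nt b(1,3) bY by blast
    moreover have "C - Y \<subset> A'" using rest d2 D(2) Y(1) by blast
    ultimately show ?thesis by blast
  qed
  have DC: "D1 \<subseteq> C - A" "D2 \<subseteq> C - A" using D(1,2) A'(2) by blast+
  have "shields C A D1 D2 \<or> shields C A D2 D1"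
    using shields_dichotomy[OF assms(1,4,5,6) DC] D by blast
  moreover have "anticomplete E D2 D1" using D anticomplete_commute by blast
  ultimately show ?thesis using *[of D1 D2] *[of D2 D1] D by blast
qed

text \<open>\<open>S\<close> is the separator inherited from the piece peeled before; demanding it
  in the first bag lets the two decompositions be glued. Each step enlarges \<open>A\<close>, and
  the induction runs on the size of what is left.\<close>

lemma no_star_path_dec:
  assumes "\<not> star C p k" "C \<subseteq> V" "connected_in E C" "connected_in E A" "p \<in> A" "A \<subseteq> C"
    and "S \<subseteq> nbrs A \<inter> C" "card S \<le> t"
  shows "\<exists>Bs. path_dec E (C - A) (k + 3 * t) Bs \<and> S \<subseteq> hd Bs"
  using assms(4-8)
proof (induction "card (C - A)" arbitrary: A S rule: less_induct)
  case less
  have fC: "finite C" using assms finite_V finite_subset by blast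
  have fS: "finite S" using less.prems fC finite_subset by blast
  show ?case
  proof (cases "pw_le E (C - A) (k + t)")
    case True
    then obtain Bs where Bs: "path_dec E (C - A) (k + t) Bs" by (auto simp: pw_le_def)
    have "path_dec E ((C - A) \<union> S) (k + t + t) (map (\<lambda>B. B \<union> S) Bs)"
      using Bs fS less.prems by (intro path_dec_Un) auto
    moreover have "(C - A) \<union> S = C - A" using less.prems by (auto simp: nbrs_def)
    moreover have "Bs \<noteq> []" using Bs by (simp add: path_dec_def)
    ultimately show ?thesis
      using path_dec_mono[of E "C - A" "k + t + t" _ "k + 3 * t"]
      by (intro exI[of _ "map (\<lambda>B. B \<union> S) Bs"]) (auto simp: hd_map)
  next
    case False
    then have "\<exists>A'. cut_off C k A A'"
      using cut_off_exists assms(1-3) less.prems by blast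
    \<comment> \<open>By minimality no further cut fits inside \<open>A'\<close>, so the piece
      \<open>A' - A\<close> has small pathwidth.\<close>
    then obtain A' where cut: "cut_off C k A A'"
      and min: "\<And>A''. cut_off C k A A'' \<Longrightarrow> card A' \<le> card A''"
      using ex_has_least_nat[of "cut_off C k A" _ card] by blast
    have A': "A \<subset> A'" "A' \<subseteq> C" "connected_in E A'" "card (nbrs A' \<inter> C) \<le> t"
      using cut by (auto simp: cut_off_def)
    have fA': "finite A'" using A' fC finite_subset by blast
    have "pw_le E (A' - A) (k + t)"
    proof (rule ccontr)
      assume "\<not> pw_le E (A' - A) (k + t)"
      then obtain A'' where A'': "A'' \<subset> A'" "cut_off C k A A''"
        using cut_off_shrink[OF assms(1-3) less.prems(1-3) cut] by blast
      then show False using min[OF A''(2)] psubset_card_mono[OF fA' A''(1)] by simp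
    qed
    then obtain As where As: "path_dec E (A' - A) (k + t) As" by (auto simp: pw_le_def)
    define Z where "Z = nbrs A' \<inter> C"
    have Z: "finite Z" "card Z \<le> t" "Z \<subseteq> C - A'" using A' fC by (auto simp: Z_def nbrs_def)
    have SZ: "S - A' \<subseteq> Z" using less.prems(4) A'(1) unfolding Z_def nbrs_def by blast
    have "card (C - A') < card (C - A)"
      using A' fC by (intro psubset_card_mono) auto
    then obtain Bs where Bs: "path_dec E (C - A') (k + 3 * t) Bs" "Z \<subseteq> hd Bs"
      using less.hyps[of A' Z] A' Z less.prems(2) unfolding Z_def by blast
    \<comment> \<open>Adding both separators everywhere costs \<open>2 * t\<close> on top of
      \<open>k + t\<close>. It places \<open>S\<close> in the first bag and \<open>Z\<close> at the
      seam; vertices of \<open>S\<close> beyond \<open>A'\<close> are neighbours of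
      \<open>A'\<close> and so belong to \<open>Z\<close>.\<close>
    define As' where "As' = map (\<lambda>B. B \<union> (S \<union> Z)) As"
    have ne: "As \<noteq> []" using As by (simp add: path_dec_def)
    have "path_dec E ((A' - A) \<union> (S \<union> Z)) (k + t + 2 * t) As'"
      unfolding As'_def
    proof (rule path_dec_Un[OF As])
      show "card (S \<union> Z) \<le> 2 * t" using card_Un_le[of S Z] Z less.prems by linarith
    qed (use fS Z in simp)
    then have As': "path_dec E ((A' - A) \<union> (S \<union> Z)) (k + 3 * t) As'"
      by (rule path_dec_mono) simp
    have ends: "S \<union> Z \<subseteq> hd As'" "S \<union> Z \<subseteq> last As'"
      using ne by (auto simp: As'_def hd_map last_map)
    have "path_dec E (((A' - A) \<union> (S \<union> Z)) \<union> (C - A')) (k + 3 * t) (As' @ Bs)"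
      using As' Bs(1)
    proof (rule path_dec_append)
      show "((A' - A) \<union> (S \<union> Z)) \<inter> (C - A') \<subseteq> last As' \<inter> hd Bs"
        using ends Bs(2) SZ by blast
      fix u v assume u: "u \<in> (A' - A) \<union> (S \<union> Z) - (C - A')" and v: "v \<in> C - A' - ((A' - A) \<union> (S \<union> Z))"
      have "u \<in> A'" using u SZ Z(3) by blast
      then show "(u, v) \<notin> E" using v by (auto simp: Z_def nbrs_def)
    qed
    moreover have "((A' - A) \<union> (S \<union> Z)) \<union> (C - A') = C - A"
      using A' Z less.prems by (auto simp: nbrs_def)
    ultimately show ?thesis
      using ends ne by (intro exI[of _ "As' @ Bs"]) (auto simp: As'_def)
  qed
qed

lemma star_exists:
  assumes "C \<subseteq> V" "connected_in E C" "p \<in> C" "\<not> pw_le E C (k + 3 * t + 1)"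
  shows "star C p k"
proof (rule ccontr)
  assume ns: "\<not> star C p k"
  obtain Bs where "path_dec E (C - {p}) (k + 3 * t) Bs"
    using no_star_path_dec[OF ns assms(1,2) connected_in_singleton, of p "{}"] assms(3) by auto
  then have "path_dec E ((C - {p}) \<union> {p}) (k + 3 * t + 1) (map (\<lambda>B. B \<union> {p}) Bs)"
    by (rule path_dec_Un) auto
  moreover have "(C - {p}) \<union> {p} = C" using assms(3) by blast
  ultimately show False using assms(4) by (auto simp: pw_le_def)
qed

end

subsection \<open>Trees of branch sets\<close>

text \<open>Addresses grow at the end, so \<open>take k x\<close> is the ancestor of
  \<open>x\<close> at level \<open>k\<close>. The vertices of \<open>bin\<close> grow at the front
  instead.\<close>

definition nodes :: "nat \<Rightarrow> nat \<Rightarrow> nat list set" where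
  "nodes d n = {x. length x \<le> n \<and> set x \<subseteq> {..<d}}"

lemma nodes_Nil [simp]: "[] \<in> nodes d n"
  by (simp add: nodes_def)

lemma nodes_Cons: "i # x \<in> nodes d (Suc n) \<longleftrightarrow> i < d \<and> x \<in> nodes d n"
  by (auto simp: nodes_def)

lemma nodes_append:
  "x \<in> nodes d m \<Longrightarrow> length x \<le> m \<Longrightarrow> y \<in> nodes d k \<Longrightarrow> length x + k \<le> n \<Longrightarrow> x @ y \<in> nodes d n"
  by (auto simp: nodes_def)

lemma nodes_prefix: "x @ y \<in> nodes d n \<Longrightarrow> x \<in> nodes d n"
  by (auto simp: nodes_def)

lemma nodes_mono: "n \<le> n' \<Longrightarrow> nodes d n \<subseteq> nodes d n'"
  by (auto simp: nodes_def)

text \<open>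
  The node \<open>x\<close> carries the branch set \<open>W x\<close>, and \<open>C x\<close> collects everything at or below \<open>x\<close>. Nothing
  restricts the edges between a branch set and those of its descendants.
\<close>

definition normal_tree ::
  "('a \<times> 'a) set \<Rightarrow> nat \<Rightarrow> nat \<Rightarrow> (nat list \<Rightarrow> 'a set) \<Rightarrow> (nat list \<Rightarrow> 'a set) \<Rightarrow> bool" where
  "normal_tree E d n W C \<longleftrightarrow>
     (\<forall>x\<in>nodes d n. connected_in E (W x) \<and> connected_in E (C x) \<and> W x \<subseteq> C x) \<and>
     (\<forall>x i. x @ [i] \<in> nodes d n \<longrightarrow> C (x @ [i]) \<subseteq> C x - W x \<and> touches E (W x) (W (x @ [i]))) \<and>
     (\<forall>x i j. x @ [i] \<in> nodes d n \<and> x @ [j] \<in> nodes d n \<and> i \<noteq> j \<longrightarrow>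
        anticomplete E (C (x @ [i])) (C (x @ [j])))"

lemma normal_treeD:
  assumes "normal_tree E d n W C"
  shows "x \<in> nodes d n \<Longrightarrow> connected_in E (W x)"
    and "x \<in> nodes d n \<Longrightarrow> connected_in E (C x)"
    and "x \<in> nodes d n \<Longrightarrow> W x \<subseteq> C x"
    and "x @ [i] \<in> nodes d n \<Longrightarrow> C (x @ [i]) \<subseteq> C x - W x"
    and "x @ [i] \<in> nodes d n \<Longrightarrow> touches E (W x) (W (x @ [i]))"
    and "x @ [i] \<in> nodes d n \<Longrightarrow> x @ [j] \<in> nodes d n \<Longrightarrow> i \<noteq> j \<Longrightarrow>
      anticomplete E (C (x @ [i])) (C (x @ [j]))"
  using assms unfolding normal_tree_def by blast+

lemma normal_tree_mono:
  assumes "normal_tree E d n W C" "x @ y \<in> nodes d n"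
  shows "C (x @ y) \<subseteq> C x"
  using assms(2)
proof (induction y rule: rev_induct)
  case (snoc i y)
  then have 1: "(x @ y) @ [i] \<in> nodes d n" by simp
  then have "C ((x @ y) @ [i]) \<subseteq> C (x @ y)" using normal_treeD(4)[OF assms(1)] by blast
  then show ?case using snoc.IH[OF nodes_prefix[OF 1]] by simp
qed simp

lemma anticomplete_subset:
  "anticomplete E X Y \<Longrightarrow> X' \<subseteq> X \<Longrightarrow> Y' \<subseteq> Y \<Longrightarrow> anticomplete E X' Y'"
  unfolding anticomplete_def touches_def by blast

lemma normal_tree_branches:
  assumes "normal_tree E d n W C" "x @ i # y \<in> nodes d n" "x @ j # z \<in> nodes d n" "i \<noteq> j"
  shows "anticomplete E (C (x @ i # y)) (C (x @ j # z))"
proof (rule anticomplete_subset)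
  have *: "(x @ [i]) @ y \<in> nodes d n" "(x @ [j]) @ z \<in> nodes d n" using assms by simp_all
  show "anticomplete E (C (x @ [i])) (C (x @ [j]))"
    using normal_treeD(6)[OF assms(1)] nodes_prefix[OF *(1)] nodes_prefix[OF *(2)] assms(4) by blast
  show "C (x @ i # y) \<subseteq> C (x @ [i])" "C (x @ j # z) \<subseteq> C (x @ [j])"
    using normal_tree_mono[OF assms(1)] * by fastforce+
qed

lemma normal_tree_subtree:
  assumes "normal_tree E d n W C" "y \<in> nodes d n" "length y + n' \<le> n"
  shows "normal_tree E d n' (\<lambda>x. W (y @ x)) (\<lambda>x. C (y @ x))"
proof -
  have *: "y @ x \<in> nodes d n" if "x \<in> nodes d n'" for x
    using nodes_append[OF assms(2) _ that assms(3)] assms(2) by (simp add: nodes_def)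
  show ?thesis
    using normal_treeD[OF assms(1)] * unfolding normal_tree_def
    by (metis append.assoc)
qed

lemma normal_tree_truncate:
  assumes "normal_tree E d n W C" "n' \<le> n"
  shows "normal_tree E d n' W C"
  using normal_tree_subtree[OF assms(1), of "[]" n'] assms(2) by simp

section \<open>Subtrees preserving levels, and leaf colourings\<close>

definition tree_emb :: "nat \<Rightarrow> nat \<Rightarrow> nat \<Rightarrow> (nat list \<Rightarrow> nat list) \<Rightarrow> bool" where
  "tree_emb d' d n e \<longleftrightarrow> e [] = [] \<and>
     (\<forall>x i. x @ [i] \<in> nodes d' n \<longrightarrow> (\<exists>j<d. e (x @ [i]) = e x @ [j])) \<and>
     (\<forall>x i j. x @ [i] \<in> nodes d' n \<and> x @ [j] \<in> nodes d' n \<and> i \<noteq> j \<longrightarrow> e (x @ [i]) \<noteq> e (x @ [j]))"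

lemma tree_emb_length:
  assumes "tree_emb d' d n e" "x \<in> nodes d' n"
  shows "length (e x) = length x \<and> e x \<in> nodes d n"
  using assms(2)
proof (induction x rule: rev_induct)
  case Nil
  then show ?case using assms by (simp add: tree_emb_def)
next
  case (snoc i x)
  then obtain j where "j < d" "e (x @ [i]) = e x @ [j]"
    using assms unfolding tree_emb_def by blast
  then show ?case using snoc nodes_prefix[OF snoc.prems] by (auto simp: nodes_def)
qed

text \<open>Ancestors go to ancestors of the same level, so a colour that names a level of an
  ancestor keeps its meaning in the subtree.\<close>

lemma tree_emb_take:
  assumes "tree_emb d' d n e" "x \<in> nodes d' n"
  shows "e (take k x) = take k (e x)"
  using assms(2)
proof (induction x rule: rev_induct)
  case Nil
  then show ?case using assms by (simp add: tree_emb_def)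
next
  case (snoc i x)
  then obtain j where j: "j < d" "e (x @ [i]) = e x @ [j]"
    using assms unfolding tree_emb_def by blast
  have x: "x \<in> nodes d' n" using nodes_prefix[OF snoc.prems] .
  then have "length (e x) = length x" using tree_emb_length assms by blast
  then show ?case using snoc.IH[OF x] j by (cases "k \<le> length x") auto
qed

lemma tree_emb_inj:
  assumes "tree_emb d' d n e"
  shows "inj_on e (nodes d' n)"
proof (rule inj_onI)
  fix x y assume "x \<in> nodes d' n" "y \<in> nodes d' n" "e x = e y"
  then show "x = y"
  proof (induction x arbitrary: y rule: rev_induct)
    case Nil
    have "length y = 0" using Nil tree_emb_length[OF assms] by (metis list.size(3))
    then show ?case by simp
  next
    case (snoc i x)
    have "length y = length (x @ [i])" using snoc.prems tree_emb_length[OF assms] by metis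
    then obtain z j where y: "y = z @ [j]" by (cases y rule: rev_cases) auto
    have *: "x \<in> nodes d' n" "z \<in> nodes d' n" using snoc.prems nodes_prefix y by blast+
    obtain a b where "e (x @ [i]) = e x @ [a]" "e (z @ [j]) = e z @ [b]"
      using assms snoc.prems y unfolding tree_emb_def by metis
    then have "e x = e z" using snoc.prems y by simp
    then have "x = z" using snoc.IH * by blast
    then show ?case using snoc.prems y assms unfolding tree_emb_def by metis
  qed
qed

lemma normal_tree_emb:
  assumes "normal_tree E d n W C" "tree_emb d' d n e"
  shows "normal_tree E d' n (\<lambda>x. W (e x)) (\<lambda>x. C (e x))"
  unfolding normal_tree_def
proof (intro conjI ballI allI impI)
  note nd = tree_emb_length[OF assms(2), THEN conjunct2]
  fix x assume "x \<in> nodes d' n"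
  then show "connected_in E (W (e x))" "connected_in E (C (e x))" "W (e x) \<subseteq> C (e x)"
    using normal_treeD(1-3)[OF assms(1) nd] by blast+
next
  note nd = tree_emb_length[OF assms(2), THEN conjunct2]
  fix x i assume x: "x @ [i] \<in> nodes d' n"
  then obtain j where j: "e (x @ [i]) = e x @ [j]" using assms(2) unfolding tree_emb_def by blast
  then have "e x @ [j] \<in> nodes d n" using nd[OF x] by simp
  then show "C (e (x @ [i])) \<subseteq> C (e x) - W (e x)" "touches E (W (e x)) (W (e (x @ [i])))"
    unfolding j using normal_treeD(4,5)[OF assms(1)] by blast+
next
  note nd = tree_emb_length[OF assms(2), THEN conjunct2]
  fix x i j assume x: "x @ [i] \<in> nodes d' n \<and> x @ [j] \<in> nodes d' n \<and> i \<noteq> j"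
  then obtain a b where ab: "e (x @ [i]) = e x @ [a]" "e (x @ [j]) = e x @ [b]" "a \<noteq> b"
    using assms(2) unfolding tree_emb_def by metis
  then have "e x @ [a] \<in> nodes d n" "e x @ [b] \<in> nodes d n" using nd x by metis+
  then show "anticomplete E (C (e (x @ [i]))) (C (e (x @ [j])))"
    unfolding ab using normal_treeD(6)[OF assms(1)] ab(3) by blast
qed

lemma pigeonhole_class:
  fixes f :: "nat \<Rightarrow> nat"
  assumes "\<And>i. i < d \<Longrightarrow> f i < c" "c * d' \<le> d" "0 < c"
  obtains y where "y < c" "d' \<le> card {i. i < d \<and> f i = y}"
proof -
  have "\<exists>y<c. d' \<le> card {i. i < d \<and> f i = y}"
  proof (rule ccontr)
    assume "\<not> ?thesis"
    then have less: "card {i. i < d \<and> f i = y} < d'" if "y < c" for y using that by force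
    have "{..<d} = (\<Union>y<c. {i. i < d \<and> f i = y})" using assms(1) by auto
    then have "d = card (\<Union>y<c. {i. i < d \<and> f i = y})" by (metis card_lessThan)
    also have "\<dots> \<le> (\<Sum>y<c. card {i. i < d \<and> f i = y})" by (rule card_UN_le) simp
    also have "\<dots> < (\<Sum>y<c. d')"
      using less assms(3) by (intro sum_strict_mono) auto
    finally show False using assms(2) by simp
  qed
  then show ?thesis using that by blast
qed

text \<open>By induction each subtree below the root contains a monochromatic subtree, and
  \<open>c * d' \<le> d\<close> leaves \<open>d'\<close> children with a common colour. The same
  ratio is used at each level, so the required arity does not grow with the height.\<close>

lemma monochromatic_subtree:
  fixes col :: "nat list \<Rightarrow> nat"
  assumes "\<And>x. x \<in> nodes d n \<Longrightarrow> length x = n \<Longrightarrow> col x < c" "c * d' \<le> d" "0 < c"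
  obtains e y where "tree_emb d' d n e" "y < c"
    "\<And>x. x \<in> nodes d' n \<Longrightarrow> length x = n \<Longrightarrow> col (e x) = y"
proof -
  have "\<exists>e y. tree_emb d' d n e \<and> y < c \<and> (\<forall>x\<in>nodes d' n. length x = n \<longrightarrow> col (e x) = y)"
    using assms(1)
  proof (induction n arbitrary: col)
    case 0
    have "tree_emb d' d 0 (\<lambda>x. x)" by (simp add: tree_emb_def nodes_def)
    then show ?case using 0[of "[]"] by (intro exI[of _ "\<lambda>x. x"] exI[of _ "col []"]) (auto simp: nodes_def)
  next
    case (Suc n)
    have "\<exists>e y. tree_emb d' d n e \<and> y < c \<and> (\<forall>x\<in>nodes d' n. length x = n \<longrightarrow> col (i # e x) = y)"
      if "i < d" for i
      by (rule Suc.IH[of "\<lambda>x. col (i # x)"]) (use Suc.prems that in \<open>simp add: nodes_Cons\<close>)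
    then obtain e f where ef: "\<And>i. i < d \<Longrightarrow> tree_emb d' d n (e i)" "\<And>i. i < d \<Longrightarrow> f i < c"
      "\<And>i x. i < d \<Longrightarrow> x \<in> nodes d' n \<Longrightarrow> length x = n \<Longrightarrow> col (i # e i x) = f i"
      by metis
    obtain y where y: "y < c" "d' \<le> card {i. i < d \<and> f i = y}"
      using pigeonhole_class[of d f c d'] ef(2) assms(2,3) by blast
    obtain T where T: "T \<subseteq> {i. i < d \<and> f i = y}" "card T = d'" "finite T"
      using obtain_subset_with_card_n[OF y(2)] by blast
    obtain h where h: "bij_betw h {..<d'} T"
      using ex_bij_betw_nat_finite[OF T(3)] T(2) by (auto simp: atLeast0LessThan)
    have hT: "h i < d" "f (h i) = y" if "i < d'" for i
      using bij_betwE[OF h] that T(1) by blast+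
    define e' where "e' x = (case x of [] \<Rightarrow> [] | i # x' \<Rightarrow> h i # e (h i) x')" for x
    have e'_simps: "e' [] = []" "\<And>i x. e' (i # x) = h i # e (h i) x" by (simp_all add: e'_def)
    have e_nil: "e (h i) [] = []" if "i < d'" for i
      using ef(1) hT that by (simp add: tree_emb_def)
    have "tree_emb d' d (Suc n) e'"
      unfolding tree_emb_def
    proof (intro conjI allI impI)
      fix x i assume x: "x @ [i] \<in> nodes d' (Suc n)"
      show "\<exists>j<d. e' (x @ [i]) = e' x @ [j]"
      proof (cases x)
        case Nil
        then show ?thesis using x hT e_nil by (auto simp: e'_simps nodes_Cons)
      next
        case (Cons a x')
        then show ?thesis using x ef(1)[of "h a"] hT[of a] by (auto simp: e'_simps nodes_Cons tree_emb_def)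
      qed
    next
      fix x i j assume x: "x @ [i] \<in> nodes d' (Suc n) \<and> x @ [j] \<in> nodes d' (Suc n) \<and> i \<noteq> j"
      show "e' (x @ [i]) \<noteq> e' (x @ [j])"
      proof (cases x)
        case Nil
        then show ?thesis
          using x bij_betw_imp_inj_on[OF h] by (auto simp: e'_simps nodes_Cons dest: inj_onD)
      next
        case (Cons a x')
        then show ?thesis using x ef(1)[of "h a"] hT[of a] by (auto simp: e'_simps nodes_Cons tree_emb_def)
      qed
    qed (simp add: e'_simps)
    moreover have "col (e' x) = y" if "x \<in> nodes d' (Suc n)" "length x = Suc n" for x
      using that hT ef(3) by (cases x) (auto simp: e'_simps nodes_Cons)
    ultimately show ?case using y(1) by blast
  qed
  then show ?thesis using that by blast
qed

text \<open>\<open>L\<close> counts the levels of the binary tree still to be found,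
  \<open>r\<close> the ancestors that may still be added to the common neighbours. A colour
  \<open>i\<close> either leaves enough height above level \<open>i\<close> for
  \<open>(L, r + 1)\<close> or enough below it for \<open>(L + 1, r)\<close>. The value 1 at
  \<open>r = 0\<close> provides the children from which a contradiction arises.\<close>

fun ramsey_height :: "nat \<Rightarrow> nat \<Rightarrow> nat" where
  "ramsey_height 0 r = 0"
| "ramsey_height (Suc L) 0 = 1"
| "ramsey_height (Suc L) (Suc r) = ramsey_height (Suc L) r + ramsey_height L (Suc r)"

lemma ramsey_height_pos: "0 < ramsey_height (Suc L) r"
  by (induction r) auto

lemma ramsey_height_le: "ramsey_height (Suc L) r \<le> (r + 1) ^ L"
proof (induction "Suc L" r arbitrary: L rule: ramsey_height.induct)
  case (3 L r)
  show ?case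
  proof (cases L)
    case 0
    then show ?thesis using 3(1) by simp
  next
    case (Suc M)
    have "ramsey_height (Suc L) (Suc r) \<le> (r + 1) ^ L + (r + 2) ^ M"
      using 3(1) 3(2)[of M] Suc by simp
    also have "\<dots> \<le> (r + 1) * (r + 2) ^ M + (r + 2) ^ M"
      using Suc by (simp add: power_mono add_mono mult_le_mono)
    finally show ?thesis using Suc by (simp add: algebra_simps)
  qed
qed simp

text \<open>
  Level \<open>L\<close> of the binary tree has to be mapped to level \<open>n\<close>: this is what allows the induction to
  append further levels.
\<close>

definition bin_model :: "('a \<times> 'a) set \<Rightarrow> nat \<Rightarrow> nat \<Rightarrow> nat \<Rightarrow> (nat list \<Rightarrow> 'a set) \<Rightarrow> bool" where
  "bin_model E L d n W \<longleftrightarrow>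
     (\<exists>\<phi> :: bool list \<Rightarrow> nat list. inj_on \<phi> {b. length b \<le> L} \<and>
        (\<forall>b. length b \<le> L \<longrightarrow> \<phi> b \<in> nodes d n) \<and> (\<forall>b. length b = L \<longrightarrow> length (\<phi> b) = n) \<and>
        (\<forall>a b. length a \<le> L \<longrightarrow> length b \<le> L \<longrightarrow> a \<noteq> b \<longrightarrow>
           (touches E (W (\<phi> a)) (W (\<phi> b)) \<longleftrightarrow> (\<exists>c. a = c # b \<or> b = c # a))))"

lemma bin_model_transfer:
  assumes "bin_model E L d' n' (\<lambda>x. W (g x))" "inj_on g (nodes d' n')"
    and "\<And>x. x \<in> nodes d' n' \<Longrightarrow> g x \<in> nodes d n"
    and "\<And>x. x \<in> nodes d' n' \<Longrightarrow> length x = n' \<Longrightarrow> length (g x) = n"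
  shows "bin_model E L d n W"
proof -
  obtain \<phi> :: "bool list \<Rightarrow> nat list" where \<phi>: "inj_on \<phi> {b. length b \<le> L}"
    "\<And>b. length b \<le> L \<Longrightarrow> \<phi> b \<in> nodes d' n'" "\<And>b. length b = L \<Longrightarrow> length (\<phi> b) = n'"
    "\<And>a b. length a \<le> L \<Longrightarrow> length b \<le> L \<Longrightarrow> a \<noteq> b \<Longrightarrow>
           (touches E (W (g (\<phi> a))) (W (g (\<phi> b))) \<longleftrightarrow> (\<exists>c. a = c # b \<or> b = c # a))"
    using assms(1) unfolding bin_model_def by blast
  have "inj_on (\<lambda>b. g (\<phi> b)) {b. length b \<le> L}"
    using \<phi>(1,2) assms(2) by (auto simp: inj_on_def)
  then show ?thesis
    unfolding bin_model_def using \<phi>(2-4) assms(3,4)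
    by (intro exI[of _ "\<lambda>b. g (\<phi> b)"]) simp
qed

section \<open>Excluding bicliques, and growing the tree of branch sets\<close>

lemma disjoint_family_avoids:
  fixes t :: nat
  assumes "finite X" "card X \<le> t" "\<And>i j. i < t + 1 \<Longrightarrow> j < t + 1 \<Longrightarrow> i \<noteq> j \<Longrightarrow> F i \<inter> F j = {}"
  obtains i where "i < t + 1" "F i \<inter> X = {}"
proof -
  have "\<exists>i<t + 1. F i \<inter> X = {}"
  proof (rule ccontr)
    assume "\<not> ?thesis"
    then have "\<forall>i<t + 1. \<exists>x. x \<in> F i \<inter> X" by blast
    then obtain f where f: "\<And>i. i < t + 1 \<Longrightarrow> f i \<in> F i \<inter> X" by metis
    have "inj_on f {..<t + 1}"
    proof (rule inj_onI)
      fix i j assume "i \<in> {..<t + 1}" "j \<in> {..<t + 1}" "f i = f j"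
      then show "i = j" using f[of i] f[of j] assms(3)[of i j] by auto
    qed
    moreover have "f ` {..<t + 1} \<subseteq> X" using f by blast
    ultimately have "t + 1 \<le> card X" using assms(1) card_inj_on_le[of f "{..<t + 1}" X] by simp
    then show False using assms(2) by simp
  qed
  then show ?thesis using that by blast
qed

context bounded_tree_dec
begin

text \<open>
  Some \<open>P i\<close> and some \<open>Q j\<close> avoid any given bag, and all sets avoiding it lie on the same side of it.
  Going up the decomposition, this side never is the side below the bag.
\<close>

lemma free_sets_outside:
  assumes "tree_dec E t S X"
    and P: "\<And>i. i < t + 1 \<Longrightarrow> connected_in E (P i)" "\<And>i. i < t + 1 \<Longrightarrow> connected_in E (Q i)"
      "\<And>i j. i < t + 1 \<Longrightarrow> j < t + 1 \<Longrightarrow> i \<noteq> j \<Longrightarrow> P i \<inter> P j = {}"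
      "\<And>i j. i < t + 1 \<Longrightarrow> j < t + 1 \<Longrightarrow> i \<noteq> j \<Longrightarrow> Q i \<inter> Q j = {}"
      "\<And>i j. i < t + 1 \<Longrightarrow> j < t + 1 \<Longrightarrow> touches E (P i) (Q j)"
    and "i < t + 1"
  shows "(P i \<inter> X = {} \<longrightarrow> P i \<inter> S = {}) \<and> (Q i \<inter> X = {} \<longrightarrow> Q i \<inter> S = {})"
  using assms(1,7)
proof (induction arbitrary: i)
  case (up S Y X)
  have inside: "D \<subseteq> S - X" if "connected_in E D" "D \<inter> X = {}" "z \<in> D" "z \<in> S" for D z
    by (rule connected_in_subset[OF that(1,3)]) (use that up.hyps in blast)+
  have step: "v \<in> S" if "u \<in> S - X" "(u, v) \<in> E \<or> (v, u) \<in> E" for u v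
    using up.hyps(5)[of u v] that sym_E by blast
  obtain a where a: "a < t + 1" "P a \<inter> Y = {}"
    using disjoint_family_avoids[of Y t P] tree_dec_root[OF up.hyps(1)] P(3) by blast
  have aS: "P a \<inter> S = {}" using up.IH a by blast
  obtain b where b: "b < t + 1" "Q b \<inter> X = {}"
    using disjoint_family_avoids[of X t Q] up.hyps P(4) by blast
  \<comment> \<open>The two families are treated in turn: the \<open>Q j\<close> are kept out of
    \<open>S\<close> by \<open>P a\<close>, which avoids the lower bag \<open>Y\<close>; then the
    \<open>P j\<close> are kept out by \<open>Q b\<close>, which avoids the new bag
    \<open>X\<close>.\<close>
  have Q: False if j: "j < t + 1" and *: "Q j \<inter> X = {}" "z \<in> Q j" "z \<in> S" for j z
  proof -
    have "Q j \<subseteq> S - X" using inside[OF P(2)[OF j] *] by blast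
    moreover obtain u v where "u \<in> P a" "v \<in> Q j" "(u, v) \<in> E"
      using P(5)[OF a(1) j] unfolding touches_def by blast
    ultimately show False using step[of v u] aS by blast
  qed
  have P': False if j: "j < t + 1" and *: "P j \<inter> X = {}" "z \<in> P j" "z \<in> S" for j z
  proof -
    have "P j \<subseteq> S - X" using inside[OF P(1)[OF j] *] by blast
    moreover obtain u v where uv: "u \<in> P j" "v \<in> Q b" "(u, v) \<in> E"
      using P(5)[OF j b(1)] unfolding touches_def by blast
    ultimately have "v \<in> S" using step[of u v] by blast
    then show False using Q[OF b uv(2)] by blast
  qed
  show ?case using Q[OF up.prems] P'[OF up.prems] by blast
qed blast+

text \<open>Some \<open>P a\<close> misses the root bag and hence all of \<open>V\<close>, although
  it is a nonempty subset of \<open>V\<close>.\<close>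

lemma no_biclique_model:
  assumes "\<And>i. i < t + 1 \<Longrightarrow> connected_in E (P i)" "\<And>i. i < t + 1 \<Longrightarrow> connected_in E (Q i)"
      "\<And>i j. i < t + 1 \<Longrightarrow> j < t + 1 \<Longrightarrow> i \<noteq> j \<Longrightarrow> P i \<inter> P j = {}"
      "\<And>i j. i < t + 1 \<Longrightarrow> j < t + 1 \<Longrightarrow> i \<noteq> j \<Longrightarrow> Q i \<inter> Q j = {}"
      "\<And>i j. i < t + 1 \<Longrightarrow> j < t + 1 \<Longrightarrow> touches E (P i) (Q j)"
      "\<And>i. i < t + 1 \<Longrightarrow> P i \<subseteq> V"
  shows False
proof -
  obtain a where a: "a < t + 1" "P a \<inter> X = {}"
    using disjoint_family_avoids[of X t P] tree_dec_root[OF tree_dec] assms(3) by blast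
  then have "P a \<inter> V = {}"
    using free_sets_outside[OF tree_dec, of P Q a] assms by blast
  then show False using assms(1,6)[OF a(1)] connected_in_nonempty by blast
qed

text \<open>Apply the induction hypothesis inside both legs of one star, starting from vertices
  adjacent to its centre, and merge the three centres. The number of legs doubles for a loss of
  \<open>3 * t + 1\<close>.\<close>

lemma many_legs:
  assumes "C \<subseteq> V" "connected_in E C" "p \<in> C" "\<not> pw_le E C (k + (m + 1) * (3 * t + 1))"
  shows "\<exists>W D. p \<in> W \<and> W \<subseteq> C \<and> connected_in E W \<and>
    (\<forall>i<2 ^ (m + 1) :: nat. connected_in E (D i) \<and> D i \<subseteq> C - W \<and> touches E W (D i) \<and> \<not> pw_le E (D i) k) \<and>
    (\<forall>i<2 ^ (m + 1). \<forall>j<2 ^ (m + 1). i \<noteq> j \<longrightarrow> anticomplete E (D i) (D j))"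
  using assms
proof (induction m arbitrary: C p)
  case 0
  then have "star C p k" using star_exists[of C p k] by (simp add: algebra_simps)
  then obtain W D1 D2 where s: "W \<subseteq> C" "D1 \<subseteq> C" "D2 \<subseteq> C" "p \<in> W"
    "connected_in E W" "connected_in E D1" "connected_in E D2"
    "W \<inter> D1 = {}" "W \<inter> D2 = {}" "anticomplete E D1 D2"
    "touches E W D1" "touches E W D2" "\<not> pw_le E D1 k" "\<not> pw_le E D2 k"
    unfolding star_def by blast
  have "i = 0 \<or> i = 1" if "i < 2 ^ (0 + 1)" for i :: nat using that by auto
  moreover have "anticomplete E D2 D1" using s anticomplete_commute by blast
  ultimately show ?case
    using s by (intro exI[of _ W] exI[of _ "\<lambda>i. if i = 0 then D1 else D2"]) auto
next
  case (Suc m)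
  let ?c = "3 * t + 1" and ?N = "2 ^ (m + 1) :: nat"
  have "\<not> pw_le E C (k + (m + 1) * ?c + ?c)" using Suc.prems(4) by (simp add: algebra_simps)
  then have "star C p (k + (m + 1) * ?c)"
    using star_exists[of C p "k + (m + 1) * ?c"] Suc.prems by (simp add: algebra_simps)
  then obtain W0 D1 D2 where s: "W0 \<subseteq> C" "D1 \<subseteq> C" "D2 \<subseteq> C" "p \<in> W0"
    "connected_in E W0" "connected_in E D1" "connected_in E D2"
    "W0 \<inter> D1 = {}" "W0 \<inter> D2 = {}" "anticomplete E D1 D2"
    "touches E W0 D1" "touches E W0 D2"
    "\<not> pw_le E D1 (k + (m + 1) * ?c)" "\<not> pw_le E D2 (k + (m + 1) * ?c)"
    unfolding star_def by blast
  obtain w1 p1 where p1: "w1 \<in> W0" "p1 \<in> D1" "(w1, p1) \<in> E" using s(11) by (auto simp: touches_def)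
  obtain w2 p2 where p2: "w2 \<in> W0" "p2 \<in> D2" "(w2, p2) \<in> E" using s(12) by (auto simp: touches_def)
  have DV: "D1 \<subseteq> V" "D2 \<subseteq> V" using s Suc.prems by blast+
  obtain W1 F1 where 1: "p1 \<in> W1" "W1 \<subseteq> D1" "connected_in E W1"
    "\<And>i. i < ?N \<Longrightarrow> connected_in E (F1 i) \<and> F1 i \<subseteq> D1 - W1 \<and> touches E W1 (F1 i) \<and> \<not> pw_le E (F1 i) k"
    "\<And>i j. i < ?N \<Longrightarrow> j < ?N \<Longrightarrow> i \<noteq> j \<Longrightarrow> anticomplete E (F1 i) (F1 j)"
    using Suc.IH[OF DV(1) s(6) p1(2) s(13)] by blast
  obtain W2 F2 where 2: "p2 \<in> W2" "W2 \<subseteq> D2" "connected_in E W2"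
    "\<And>i. i < ?N \<Longrightarrow> connected_in E (F2 i) \<and> F2 i \<subseteq> D2 - W2 \<and> touches E W2 (F2 i) \<and> \<not> pw_le E (F2 i) k"
    "\<And>i j. i < ?N \<Longrightarrow> j < ?N \<Longrightarrow> i \<noteq> j \<Longrightarrow> anticomplete E (F2 i) (F2 j)"
    using Suc.IH[OF DV(2) s(7) p2(2) s(14)] by blast
  define W where "W = W0 \<union> W1 \<union> W2"
  define F where "F i = (if i < ?N then F1 i else F2 (i - ?N))" for i
  have "touches E W0 W1" "touches E (W0 \<union> W1) W2" using p1 1(1) p2 2(1) by (auto simp: touches_def)
  then have W: "connected_in E W" 
    unfolding W_def using connected_in_Un[OF connected_in_Un[OF s(5) 1(3)] 2(3)] by blast
  have disj: "D1 \<inter> D2 = {}" using s(10) by (simp add: anticomplete_def)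
  have F: "connected_in E (F i) \<and> F i \<subseteq> C - W \<and> touches E W (F i) \<and> \<not> pw_le E (F i) k"
    if "i < 2 ^ (Suc m + 1)" for i
  proof (cases "i < ?N")
    case True
    have *: "connected_in E (F1 i)" "F1 i \<subseteq> D1 - W1" "touches E W1 (F1 i)" "\<not> pw_le E (F1 i) k"
      using 1(4)[OF True] by auto
    have "F1 i \<subseteq> C - W" using *(2) 2(2) s(2,8) disj unfolding W_def by blast
    moreover have "touches E W (F1 i)" using *(3) unfolding W_def touches_def by blast
    ultimately show ?thesis using * True by (simp add: F_def)
  next
    case False
    then have "i - ?N < ?N" using that by simp
    then have *: "connected_in E (F2 (i - ?N))" "F2 (i - ?N) \<subseteq> D2 - W2" "touches E W2 (F2 (i - ?N))"
        "\<not> pw_le E (F2 (i - ?N)) k"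
      using 2(4) by auto
    have "F2 (i - ?N) \<subseteq> C - W" using *(2) 1(2) s(3,9) disj unfolding W_def by blast
    moreover have "touches E W (F2 (i - ?N))" using *(3) unfolding W_def touches_def by blast
    ultimately show ?thesis using * False by (simp add: F_def)
  qed
  have sub: "F i \<subseteq> D1" if "i < ?N" for i using 1(4) that by (auto simp: F_def)
  have sub': "F i \<subseteq> D2" if "\<not> i < ?N" "i < 2 ^ (Suc m + 1)" for i
  proof -
    have "i - ?N < ?N" using that by simp
    then show ?thesis using 2(4)[of "i - ?N"] that(1) unfolding F_def by auto
  qed
  have "anticomplete E (F i) (F j)" if "i < 2 ^ (Suc m + 1)" "j < 2 ^ (Suc m + 1)" "i \<noteq> j" for i j
  proof -
    have D21: "anticomplete E D2 D1" using s anticomplete_commute by blast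
    consider "i < ?N" "j < ?N" | "i < ?N" "\<not> j < ?N" | "\<not> i < ?N" "j < ?N" | "\<not> i < ?N" "\<not> j < ?N"
      by blast
    then show ?thesis
    proof cases
      case 1
      then show ?thesis using \<open>\<And>i j. i < ?N \<Longrightarrow> j < ?N \<Longrightarrow> i \<noteq> j \<Longrightarrow> anticomplete E (F1 i) (F1 j)\<close> that
        by (simp add: F_def)
    next
      case 2
      then show ?thesis using anticomplete_subset[OF s(10) sub sub'] that by blast
    next
      case 3
      then show ?thesis using anticomplete_subset[OF D21 sub' sub] that by blast
    next
      case 4
      then have "i - ?N < ?N" "j - ?N < ?N" "i - ?N \<noteq> j - ?N" using that by auto
      then show ?thesis
        using 4 \<open>\<And>i j. i < ?N \<Longrightarrow> j < ?N \<Longrightarrow> i \<noteq> j \<Longrightarrow> anticomplete E (F2 i) (F2 j)\<close>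
        by (simp add: F_def)
    qed
  qed
  moreover have "p \<in> W" "W \<subseteq> C" using s 1 2 by (auto simp: W_def)
  ultimately show ?case using W F by blast
qed

text \<open>The prescribed vertex \<open>p\<close> links the levels: in each leg the construction
  restarts at a neighbour of the centre, so the parent's branch set touches the child's branch set
  and not merely the region below it.\<close>

lemma normal_tree_exists:
  assumes "C0 \<subseteq> V" "connected_in E C0" "p \<in> C0"
    and "\<not> pw_le E C0 (n * ((m + 1) * (3 * t + 1)))"
  shows "\<exists>W C. normal_tree E (2 ^ (m + 1)) n W C \<and> C [] = C0 \<and> p \<in> W []"
  using assms
proof (induction n arbitrary: C0 p)
  case 0
  then show ?case
    by (intro exI[of _ "\<lambda>_. {p}"] exI[of _ "\<lambda>_. C0"])
       (auto simp: normal_tree_def nodes_def connected_in_singleton)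
next
  case (Suc n)
  let ?k = "n * ((m + 1) * (3 * t + 1))" and ?d = "2 ^ (m + 1) :: nat"
  have "\<not> pw_le E C0 (?k + (m + 1) * (3 * t + 1))" using Suc.prems(4) by (simp add: algebra_simps)
  from many_legs[OF Suc.prems(1-3) this] obtain W0 D where
    "p \<in> W0 \<and> W0 \<subseteq> C0 \<and> connected_in E W0 \<and>
    (\<forall>i<?d. connected_in E (D i) \<and> D i \<subseteq> C0 - W0 \<and> touches E W0 (D i) \<and> \<not> pw_le E (D i) ?k) \<and>
    (\<forall>i<?d. \<forall>j<?d. i \<noteq> j \<longrightarrow> anticomplete E (D i) (D j))" by (elim exE)
  then have D: "p \<in> W0" "W0 \<subseteq> C0" "connected_in E W0"
    "\<And>i. i < ?d \<Longrightarrow> connected_in E (D i) \<and> D i \<subseteq> C0 - W0 \<and> touches E W0 (D i) \<and> \<not> pw_le E (D i) ?k"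
    "\<And>i j. i < ?d \<Longrightarrow> j < ?d \<Longrightarrow> i \<noteq> j \<Longrightarrow> anticomplete E (D i) (D j)"
    by blast+
  have "\<exists>W C. normal_tree E ?d n W C \<and> C [] = D i \<and> touches E W0 (W [])" if i: "i < ?d" for i
  proof -
    obtain w q where q: "w \<in> W0" "q \<in> D i" "(w, q) \<in> E" using D(4)[OF i] by (auto simp: touches_def)
    have "D i \<subseteq> V" using D(4)[OF i] Suc.prems by blast
    then have "\<exists>W C. normal_tree E ?d n W C \<and> C [] = D i \<and> q \<in> W []"
      using Suc.IH[of "D i" q] q D(4)[OF i] by blast
    then show ?thesis using q by (auto simp: touches_def)
  qed
  then obtain Wf Cf where f: "\<And>i. i < ?d \<Longrightarrow> normal_tree E ?d n (Wf i) (Cf i)"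
    "\<And>i. i < ?d \<Longrightarrow> Cf i [] = D i" "\<And>i. i < ?d \<Longrightarrow> touches E W0 (Wf i [])" by metis
  define W where "W x = (case x of [] \<Rightarrow> W0 | i # y \<Rightarrow> Wf i y)" for x
  define C where "C x = (case x of [] \<Rightarrow> C0 | i # y \<Rightarrow> Cf i y)" for x
  have simps: "W [] = W0" "C [] = C0" "W (i # y) = Wf i y" "C (i # y) = Cf i y" for i y
    by (simp_all add: W_def C_def)
  have "normal_tree E ?d (Suc n) W C"
    unfolding normal_tree_def
  proof (intro conjI ballI allI impI)
    fix x assume x: "x \<in> nodes ?d (Suc n)"
    show "connected_in E (W x)" "connected_in E (C x)" "W x \<subseteq> C x"
      using x D(2,3) Suc.prems(2) normal_treeD(1-3)[OF f(1)] by (cases x; simp add: simps nodes_Cons)+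
  next
    fix x i assume x: "x @ [i] \<in> nodes ?d (Suc n)"
    show "C (x @ [i]) \<subseteq> C x - W x"
    proof (cases x)
      case Nil
      then show ?thesis using x D(4) f(2) by (simp add: simps nodes_Cons)
    next
      case (Cons a y)
      then show ?thesis using x normal_treeD(4)[OF f(1)[of a], of y i] by (simp add: simps nodes_Cons)
    qed
    show "touches E (W x) (W (x @ [i]))"
    proof (cases x)
      case Nil
      then show ?thesis using x f(3) by (simp add: simps nodes_Cons)
    next
      case (Cons a y)
      then show ?thesis using x normal_treeD(5)[OF f(1)[of a], of y i] by (simp add: simps nodes_Cons)
    qed
  next
    fix x i j assume x: "x @ [i] \<in> nodes ?d (Suc n) \<and> x @ [j] \<in> nodes ?d (Suc n) \<and> i \<noteq> j"
    show "anticomplete E (C (x @ [i])) (C (x @ [j]))"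
    proof (cases x)
      case Nil
      then show ?thesis using x D(5) f(2) by (simp add: simps nodes_Cons)
    next
      case (Cons a y)
      then show ?thesis using x normal_treeD(6)[OF f(1)[of a], of y i j] by (simp add: simps nodes_Cons)
    qed
  qed
  then show ?case using D(1) by (intro exI[of _ W] exI[of _ C]) (simp add: simps)
qed

end

subsection \<open>The Ramsey argument\<close>

lemma normal_tree_parallel:
  assumes nt: "normal_tree E d n W C" and xy: "x \<in> nodes d n" "y \<in> nodes d n" "x \<parallel> y"
  shows "anticomplete E (W x) (W y)"
proof (rule anticomplete_subset)
  obtain z p xs q ys where *: "p \<noteq> q" "x = z @ p # xs" "y = z @ q # ys"
    using parallel_decomp[OF xy(3)] by blast
  show "anticomplete E (C x) (C y)"
    using normal_tree_branches[OF nt, of z p xs q ys] xy * by simp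
qed (use normal_treeD(3)[OF nt] xy in auto)

lemma normal_tree_disjoint:
  assumes nt: "normal_tree E d n W C" and xy: "x \<in> nodes d n" "y \<in> nodes d n" "x \<noteq> y"
  shows "W x \<inter> W y = {}"
proof -
  have *: "W u \<inter> W v = {}" if uv: "u \<in> nodes d n" "v \<in> nodes d n" "strict_prefix u v" for u v
  proof -
    obtain i z where v: "v = (u @ [i]) @ z" using uv(3) by (auto elim: strict_prefixE')
    then have "u @ [i] \<in> nodes d n" using uv(2) nodes_prefix by blast
    then have "C (u @ [i]) \<subseteq> C u - W u" using normal_treeD(4)[OF nt] by blast
    moreover have "W v \<subseteq> C (u @ [i])"
      using normal_treeD(3)[OF nt uv(2)] normal_tree_mono[OF nt, of "u @ [i]" z] uv(2) v by blast
    ultimately show ?thesis by blast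
  qed
  consider "strict_prefix x y" | "strict_prefix y x" | "x \<parallel> y"
    using xy(3) by (auto simp: parallel_def strict_prefix_def)
  then show ?thesis
    using *[of x y] *[of y x] normal_tree_parallel[OF nt xy(1,2)] xy
    by cases (auto simp: anticomplete_def)
qed

context bounded_tree_dec
begin

text \<open>A node at level \<open>n\<close> touches its ancestor at level \<open>i\<close> and none
  above it, while incomparable nodes are anticomplete. Among the nodes of the model it therefore
  sees only the old leaf above it. No node strictly between the two levels is used.\<close>

lemma bin_model_extend:
  assumes nt: "normal_tree E d n W C" and d: "2 \<le> d" and i: "i < n"
    and touch: "\<And>x. x \<in> nodes d n \<Longrightarrow> length x = n \<Longrightarrow> touches E (W (take i x)) (W x)"
    and first: "\<And>x k. x \<in> nodes d n \<Longrightarrow> length x = n \<Longrightarrow> k < i \<Longrightarrow> \<not> touches E (W (take k x)) (W x)"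
    and model: "bin_model E L d i W"
  shows "bin_model E (Suc L) d n W"
proof -
  obtain \<phi> :: "bool list \<Rightarrow> nat list" where \<phi>: "inj_on \<phi> {b. length b \<le> L}"
    "\<And>b. length b \<le> L \<Longrightarrow> \<phi> b \<in> nodes d i" "\<And>b. length b = L \<Longrightarrow> length (\<phi> b) = i"
    "\<And>a b. length a \<le> L \<Longrightarrow> length b \<le> L \<Longrightarrow> a \<noteq> b \<Longrightarrow>
           (touches E (W (\<phi> a)) (W (\<phi> b)) \<longleftrightarrow> (\<exists>c. a = c # b \<or> b = c # a))"
    using model unfolding bin_model_def by blast
  \<comment> \<open>The entry 0 or 1 separates the two children; the zeros merely descend to level
    \<open>n\<close>.\<close>
  define leaf where "leaf c b = \<phi> b @ (if c then 1 else 0) # replicate (n - i - 1) 0"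
    for c :: bool and b :: "bool list"
  define \<psi> where "\<psi> b = (if length b \<le> L then \<phi> b else leaf (hd b) (tl b))" for b
  have leaf: "leaf c b \<in> nodes d n" "length (leaf c b) = n" "take i (leaf c b) = \<phi> b"
    if "length b = L" for c b
    using \<phi>(2)[of b] \<phi>(3)[of b] that d i by (auto simp: leaf_def nodes_def)
  have leaf_inj: "c = c' \<and> b = b'"
    if "length b = L" "length b' = L" "leaf c b = leaf c' b'" for c c' b b'
  proof -
    have "\<phi> b = \<phi> b'" using leaf(3) that by metis
    then have "b = b'" using \<phi>(1) that by (auto simp: inj_on_def)
    then show ?thesis using that(3) by (auto simp: leaf_def split: if_splits)
  qed
  have short: "length (\<phi> b) < n" if "length b \<le> L" for b
    using \<phi>(2)[OF that] i by (auto simp: nodes_def)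
  have leaves: "b = hd b # tl b \<and> length (tl b) = L" if "length b = Suc L" for b :: "bool list"
    using that by (cases b) auto
  have inj: "inj_on \<psi> {b. length b \<le> Suc L}"
  proof (rule inj_onI)
    fix a b assume "a \<in> {b. length b \<le> Suc L}" "b \<in> {b. length b \<le> Suc L}" and eq: "\<psi> a = \<psi> b"
    then have *: "length a \<le> L \<or> length a = Suc L" "length b \<le> L \<or> length b = Suc L" by auto
    have len: "length (\<psi> c) = n \<longleftrightarrow> length c = Suc L" if "length c \<le> L \<or> length c = Suc L" for c
    proof (cases "length c \<le> L")
      case True
      then show ?thesis using short[of c] by (auto simp: \<psi>_def)
    next
      case False
      then show ?thesis using leaf(2) leaves[of c] that by (auto simp: \<psi>_def)
    qed
    show "a = b"
    proof (cases "length a = Suc L")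
      case True
      then have "length b = Suc L" using len[of a] len[of b] * eq by auto
      then show ?thesis
        using leaf_inj[of "tl a" "tl b" "hd a" "hd b"] leaves[of a] leaves[of b] True eq
        by (auto simp: \<psi>_def)
    next
      case False
      then have "length b \<noteq> Suc L" using len[of a] len[of b] * eq by auto
      then show ?thesis using False * eq \<phi>(1) by (auto simp: \<psi>_def inj_on_def)
    qed
  qed
  have branch: "\<not> touches E (W x) (W y)"
    if xy: "x \<in> nodes d n" "y \<in> nodes d n" and inc: "length x \<le> length y" "x \<noteq> take (length x) y" for x y
  proof -
    have "\<not> prefix x y" using inc(2) by (auto simp: prefix_def)
    moreover have "\<not> prefix y x"
      using inc by (auto elim!: prefixE)
    ultimately have "anticomplete E (W x) (W y)"
      using normal_tree_parallel[OF nt xy] by (simp add: parallel_def)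
    then show ?thesis by (simp add: anticomplete_def)
  qed
  have new: "touches E (W (\<psi> a)) (W (\<psi> b)) \<longleftrightarrow> (\<exists>c. a = c # b \<or> b = c # a)"
    if a: "length a \<le> Suc L" and b: "length b = Suc L" and ab: "a \<noteq> b" for a b
  proof -
    have b': "\<psi> b = leaf (hd b) (tl b)" "length (tl b) = L" "b = hd b # tl b"
      using b leaves[of b] by (auto simp: \<psi>_def)
    note lb = leaf[OF b'(2), of "hd b"]
    show ?thesis
    proof (cases "length a \<le> L")
      case True
      then have a': "\<psi> a = \<phi> a" "\<phi> a \<in> nodes d i" using \<phi>(2) by (auto simp: \<psi>_def)
      then have "\<phi> a \<in> nodes d n" "length (\<phi> a) \<le> i" using nodes_mono[of i n d] i by (auto simp: nodes_def)
      have bc: "(\<exists>c. a = c # b \<or> b = c # a) \<longleftrightarrow> a = tl b"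
        using True b b'(3) by (cases b) auto
      show ?thesis
      proof (cases "\<phi> a = take (length (\<phi> a)) (leaf (hd b) (tl b))")
        case pre: True
        show ?thesis
        proof (cases "length (\<phi> a) = i")
          case True
          then have "\<phi> a = \<phi> (tl b)" using pre lb(3) by simp
          then have "a = tl b" using \<phi>(1) \<open>length a \<le> L\<close> b'(2) by (auto simp: inj_on_def)
          then show ?thesis using bc touch[OF lb(1,2)] lb(3) a' b'(1) by simp
        next
          case False
          then have "length (\<phi> a) < i" using \<open>length (\<phi> a) \<le> i\<close> by simp
          then have "\<not> touches E (W (\<phi> a)) (W (leaf (hd b) (tl b)))" using first[OF lb(1,2)] pre by metis
          moreover have "a \<noteq> tl b" using False \<phi>(3)[OF b'(2)] by auto
          ultimately show ?thesis using bc a' b'(1) by simp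
        qed
      next
        case False
        have "\<not> touches E (W (\<phi> a)) (W (leaf (hd b) (tl b)))"
          using branch[OF \<open>\<phi> a \<in> nodes d n\<close> lb(1) _ False] lb(2) \<open>length (\<phi> a) \<le> i\<close> i by simp
        moreover have "a \<noteq> tl b"
          using False lb(3) \<phi>(3)[OF b'(2)] by auto
        ultimately show ?thesis using bc a' b'(1) by simp
      qed
    next
      case False
      then have a2: "length a = Suc L" using a by simp
      then have a': "\<psi> a = leaf (hd a) (tl a)" "length (tl a) = L"
        using leaves[of a] by (auto simp: \<psi>_def)
      note la = leaf[OF a'(2), of "hd a"]
      have "\<psi> a \<noteq> \<psi> b" using inj a b ab by (auto simp: inj_on_def)
      then have "\<not> touches E (W (\<psi> a)) (W (\<psi> b))"
        using branch[OF la(1) lb(1)] la(2) lb(2) a'(1) b'(1) by simp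
      moreover have "\<not> (\<exists>c. a = c # b \<or> b = c # a)" using a2 b by auto
      ultimately show ?thesis by blast
    qed
  qed
  have "touches E (W (\<psi> a)) (W (\<psi> b)) \<longleftrightarrow> (\<exists>c. a = c # b \<or> b = c # a)"
    if ab: "length a \<le> Suc L" "length b \<le> Suc L" "a \<noteq> b" for a b
  proof -
    consider "length b = Suc L" | "length a = Suc L" | "length a \<le> L" "length b \<le> L"
      using ab(1,2) by linarith
    then show ?thesis
    proof cases
      case 1
      then show ?thesis using new ab by blast
    next
      case 2
      then show ?thesis using new[of b a] ab touches_commute by metis
    next
      case 3
      then show ?thesis using \<phi>(4) ab by (simp add: \<psi>_def)
    qed
  qed
  moreover have "\<psi> b \<in> nodes d n" if "length b \<le> Suc L" for b
  proof (cases "length b \<le> L")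
    case True
    then show ?thesis using \<phi>(2) nodes_mono[of i n d] i by (auto simp: \<psi>_def)
  next
    case False
    then show ?thesis using leaf(1) leaves[of b] that by (simp add: \<psi>_def)
  qed
  moreover have "length (\<psi> b) = n" if "length b = Suc L" for b
    using leaf(2) leaves[OF that] that by (simp add: \<psi>_def)
  ultimately show ?thesis unfolding bin_model_def using inj by blast
qed

text \<open>
  The sets \<open>P j\<close> are the \<open>s\<close> ancestors already passed; \<open>r\<close> counts how many more of them the
  treewidth leaves room for.
\<close>

lemma ramsey_bin_model:
  assumes "normal_tree E d n W C" "C [] \<subseteq> V"
    and "s + r = t + 1"
    and "\<And>j. j < s \<Longrightarrow> connected_in E (P j)" "\<And>j. j < s \<Longrightarrow> P j \<subseteq> V" "\<And>j. j < s \<Longrightarrow> P j \<inter> C [] = {}"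
    and "\<And>j j'. j < s \<Longrightarrow> j' < s \<Longrightarrow> j \<noteq> j' \<Longrightarrow> P j \<inter> P j' = {}"
    and "\<And>j x. j < s \<Longrightarrow> x \<in> nodes d n \<Longrightarrow> length x = n \<Longrightarrow> touches E (P j) (C x)"
    and "ramsey_height L r \<le> n" "n \<le> N" "(t + 2) * N ^ (L + r) \<le> d" "0 < N"
  shows "bin_model E L d n W"
  using assms
proof (induction L r arbitrary: d n W C s P rule: ramsey_height.induct)
  case (1 r)
  have "0 < (t + 2) * N ^ (0 + r)" using 1(12) by simp
  then have "0 < d" using 1(11) by linarith
  then show ?case
    unfolding bin_model_def
    \<comment> \<open>The single vertex is itself a leaf, so it has to be placed at level
      \<open>n\<close>.\<close>
    by (intro exI[of _ "\<lambda>_. replicate n 0"]) (auto simp: nodes_def)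
next
  case (2 L)
  have "0 < N ^ (Suc L + 0)" using 2(12) by simp
  then have "(t + 2) * 1 \<le> (t + 2) * N ^ (Suc L + 0)" by (intro mult_le_mono2) linarith
  then have "(t + 2) * 1 \<le> d" using 2(11) by (rule order_trans)
  then have d: "t + 2 \<le> d" by simp
  have s: "s = t + 1" using 2(3) by simp
  have n: "0 < n" using 2(9) by simp
  \<comment> \<open>No room for further ancestors is left. The \<open>t + 1\<close> sets
    \<open>P j\<close>, together with regions of leaves below \<open>t + 1\<close> different
    children of the root, form a forbidden biclique.\<close>
  define Q where "Q i = C (i # replicate (n - 1) 0)" for i :: nat
  have node: "i # replicate (n - 1) 0 \<in> nodes d n" "length (i # replicate (n - 1) 0) = n"
    if "i < t + 1" for i :: nat
    using that d n by (auto simp: nodes_def)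
  have False
  proof (rule no_biclique_model[of P Q])
    show "connected_in E (Q i)" if "i < t + 1" for i
      unfolding Q_def using normal_treeD(2)[OF 2(1) node(1)[OF that]] .
    show "Q i \<inter> Q j = {}" if "i < t + 1" "j < t + 1" "i \<noteq> j" for i j
      using normal_tree_branches[OF 2(1), of "[]" i _ j] node(1) that
      unfolding Q_def anticomplete_def by simp
    show "touches E (P i) (Q j)" if "i < t + 1" "j < t + 1" for i j
      unfolding Q_def using 2(8) node that s by blast
  qed (use 2 s in auto)
  then show ?case ..
next
  case (3 L r)
  note nt = 3(3)
  \<comment> \<open>Both recursive calls lower \<open>L + r\<close> by one and hence need the same
    arity. The factor \<open>N\<close> released covers the colours, of which there are
    \<open>n \<le> N\<close>.\<close>
  let ?d = "(t + 2) * N ^ (L + Suc r)"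
  have n: "0 < n" using 3(11) ramsey_height_pos[of L "Suc r"] by linarith
  have "n * ?d \<le> N * ?d" using 3(12) by simp
  also have "\<dots> \<le> d" using 3(13) by (simp add: algebra_simps)
  finally have nd: "n * ?d \<le> d" .
  define col where "col x = (LEAST k. touches E (W (take k x)) (W x))" for x
  have col: "touches E (W (take (col x) x)) (W x)" "col x < n" "\<And>k. k < col x \<Longrightarrow> \<not> touches E (W (take k x)) (W x)"
    if x: "x \<in> nodes d n" "length x = n" for x
  proof -
    obtain y i where y: "x = y @ [i]" "length y = n - 1" using x(2) n by (cases x rule: rev_cases) auto
    then have *: "touches E (W (take (n - 1) x)) (W x)"
      using normal_treeD(5)[OF nt, of y i] x by simp
    show "touches E (W (take (col x) x)) (W x)"
      unfolding col_def using * by (rule LeastI)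
    have "col x \<le> n - 1" unfolding col_def using * by (rule Least_le)
    then show "col x < n" using n by simp
    show "\<And>k. k < col x \<Longrightarrow> \<not> touches E (W (take k x)) (W x)"
      unfolding col_def by (rule not_less_Least)
  qed
  obtain e i where e: "tree_emb ?d d n e" "i < n"
    "\<And>x. x \<in> nodes ?d n \<Longrightarrow> length x = n \<Longrightarrow> col (e x) = i"
    using monochromatic_subtree[of d n col n ?d] col(2) nd n by blast
  define W' where "W' x = W (e x)" for x
  define C' where "C' x = C (e x)" for x
  have nt': "normal_tree E ?d n W' C'"
    unfolding W'_def C'_def using normal_tree_emb[OF nt e(1)] .
  have C'_nil: "C' [] = C []" using e(1) by (simp add: C'_def tree_emb_def)
  note el = tree_emb_length[OF e(1)]
  have touch: "touches E (W' (take i x)) (W' x)"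
    and first: "\<And>k. k < i \<Longrightarrow> \<not> touches E (W' (take k x)) (W' x)"
    if x: "x \<in> nodes ?d n" "length x = n" for x
  proof -
    have ex: "e x \<in> nodes d n" "length (e x) = n" using el[OF x(1)] x(2) by auto
    show "touches E (W' (take i x)) (W' x)"
      using col(1)[OF ex] e(3)[OF x] tree_emb_take[OF e(1) x(1)] by (simp add: W'_def)
    show "\<And>k. k < i \<Longrightarrow> \<not> touches E (W' (take k x)) (W' x)"
      using col(3)[OF ex] e(3)[OF x] tree_emb_take[OF e(1) x(1)] by (simp add: W'_def)
  qed
  have Pt: "touches E (P j) (C' x)" if "j < s" "x \<in> nodes ?d n" "length x = n" for j x
    unfolding C'_def using 3(10)[OF that(1)] el that by simp
  have pos: "0 < N ^ (L + Suc r)" using 3(14) by simp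
  then have "(t + 2) * 1 \<le> ?d" by (intro mult_le_mono2) linarith
  then have d2: "t + 2 \<le> ?d" by simp
  have mono: "touches E A (C' x)" if "touches E A (C' (x @ y))" "x @ y \<in> nodes ?d n" for A x y
    using that normal_tree_mono[OF nt' that(2)] unfolding touches_def by blast
  have "bin_model E (Suc L) ?d n W'"
  proof (cases "ramsey_height L (Suc r) \<le> i")
    case True
    have "bin_model E L ?d i W'"
    proof (rule 3(2)[of ?d i W' C' s P])
      show "normal_tree E ?d i W' C'" using normal_tree_truncate[OF nt'] e(2) by simp
      \<comment> \<open>Truncation is the reason for asking that \<open>P j\<close> touch
        \<open>C x\<close> and not \<open>W x\<close>: it touches the region of some old leaf below
        \<open>x\<close>.\<close>
      show "touches E (P j) (C' x)" if j: "j < s" and x: "x \<in> nodes ?d i" "length x = i" for j x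
      proof -
        have "x @ replicate (n - i) 0 \<in> nodes ?d n" "length (x @ replicate (n - i) 0) = n"
          using x e(2) pos by (auto simp: nodes_def)
        then show ?thesis using Pt[OF j] mono by blast
      qed
    qed (use 3(4-9,12,14) e(2) True C'_nil in auto)
    then show ?thesis
      using bin_model_extend[OF nt' _ e(2)] touch first d2 by simp
  next
    case False
    \<comment> \<open>Any node \<open>y\<close> of level \<open>i\<close> would do. All leaves below
      its child \<open>z\<close> touch \<open>W' y\<close>, and \<open>W' y\<close> is disjoint from
      the region of \<open>z\<close>, so it can join the sets \<open>P j\<close> for the subtree at
      \<open>z\<close>.\<close>
    define y :: "nat list" where "y = replicate i 0"
    define z where "z = y @ [0]"
    define n' where "n' = n - i - 1"
    have z: "z \<in> nodes ?d n" "length z + n' = n"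
      using e(2) pos by (auto simp: z_def y_def n'_def nodes_def)
    have yn: "y \<in> nodes ?d n" "length y = i" using z(1) nodes_prefix by (auto simp: z_def y_def)
    have znode: "z @ x \<in> nodes ?d n" if "x \<in> nodes ?d n'" for x
      using nodes_append[OF z(1) _ that] z by simp
    define P' where "P' = P(s := W' y)"
    have CyC: "C' y \<subseteq> C []" using normal_tree_mono[OF nt', of "[]" y] yn C'_nil by simp
    have WyC: "W' y \<subseteq> C []" using normal_treeD(3)[OF nt' yn(1)] CyC by blast
    have CzC: "C' z \<subseteq> C' y - W' y" using normal_treeD(4)[OF nt'] z by (simp add: z_def)
    have "bin_model E (Suc L) ?d n' (\<lambda>x. W' (z @ x))"
    proof (rule 3(1)[of ?d n' "\<lambda>x. W' (z @ x)" "\<lambda>x. C' (z @ x)" "Suc s" P'])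
      show "normal_tree E ?d n' (\<lambda>x. W' (z @ x)) (\<lambda>x. C' (z @ x))"
        using normal_tree_subtree[OF nt' z(1)] z(2) by simp
      show "C' (z @ []) \<subseteq> V" using CzC CyC 3(4) by auto
      show "connected_in E (P' j)" "P' j \<subseteq> V" "P' j \<inter> C' (z @ []) = {}" if "j < Suc s" for j
      proof -
        have "connected_in E (P' j) \<and> P' j \<subseteq> V \<and> P' j \<inter> C' z = {}"
        proof (cases "j = s")
          case True
          have "W' y \<inter> C' z = {}" "W' y \<subseteq> V" using CzC WyC 3(4) by blast+
          then show ?thesis using True normal_treeD(1)[OF nt' yn(1)] by (simp add: P'_def)
        next
          case False
          then have js: "j < s" using that by simp
          have "P j \<inter> C' z = {}" using CzC CyC 3(8)[OF js] by blast
          then show ?thesis using False 3(6,7)[OF js] by (simp add: P'_def)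
        qed
        then show "connected_in E (P' j)" "P' j \<subseteq> V" "P' j \<inter> C' (z @ []) = {}" by simp_all
      qed
      show "P' j \<inter> P' j' = {}" if "j < Suc s" "j' < Suc s" "j \<noteq> j'" for j j'
      proof -
        have *: "P k \<inter> W' y = {}" if "k < s" for k using 3(8)[OF that] WyC by blast
        have **: "W' y \<inter> P k = {}" if "k < s" for k using *[OF that] by blast
        show ?thesis
          using that *[of j] **[of j'] 3(9)[of j j']
          by (cases "j = s"; cases "j' = s") (simp_all add: P'_def)
      qed
      show "touches E (P' j) (C' (z @ x))" if j: "j < Suc s" and x: "x \<in> nodes ?d n'" "length x = n'" for j x
      proof -
        have zx: "z @ x \<in> nodes ?d n" "length (z @ x) = n" using znode x z by auto
        have "take i (z @ x) = y" using yn by (simp add: z_def)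
        then have "touches E (W' y) (W' (z @ x))" using touch[OF zx] by simp
        then have "touches E (W' y) (C' (z @ x))"
          using normal_treeD(3)[OF nt' zx(1)] unfolding touches_def by blast
        then show ?thesis using j Pt[OF _ zx] by (auto simp: P'_def less_Suc_eq)
      qed
      show "ramsey_height (Suc L) r \<le> n'" using 3(11) False by (simp add: n'_def)
      show "n' \<le> N" using 3(12) by (simp add: n'_def)
    qed (use 3(5,14) in auto)
    then show ?thesis
      by (rule bin_model_transfer) (use znode z in \<open>auto simp: inj_on_def\<close>)
  qed
  then show ?case
    unfolding W'_def
    by (rule bin_model_transfer) (use tree_emb_inj[OF e(1)] el in auto)
qed

end

subsection \<open>Branch sets and induced minors\<close>

lemma pair_graphI:
  assumes "finite (pverts G)" "parcs G \<subseteq> pverts G \<times> pverts G" "sym (parcs G)" "irrefl (parcs G)"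
  shows "pair_graph G"
proof -
  have "finite (parcs G)" using assms(1,2) finite_subset by blast
  then show ?thesis
    using assms by unfold_locales (auto simp: symmetric_def irrefl_def)
qed

lemma pair_graphD:
  assumes "pair_graph G"
  shows "finite (pverts G)" "parcs G \<subseteq> pverts G \<times> pverts G" "sym (parcs G)" "irrefl (parcs G)"
proof -
  interpret pair_graph G by fact
  show "finite (pverts G)" by (rule pair_finite_verts)
  show "parcs G \<subseteq> pverts G \<times> pverts G" using in_arcsD1 in_arcsD2 by auto
  show "sym (parcs G)" using pair_sym_arcs by (simp add: symmetric_def)
  show "irrefl (parcs G)" unfolding irrefl_def using pair_no_loops by force
qed

lemma connected_in_cong:
  assumes "\<And>u v. u \<in> S \<Longrightarrow> v \<in> S \<Longrightarrow> (u, v) \<in> E \<longleftrightarrow> (u, v) \<in> E'"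
  shows "connected_in E S \<longleftrightarrow> connected_in E' S"
proof -
  have "(\<forall>u\<in>R \<inter> S. \<forall>v\<in>S. (u, v) \<in> E \<longrightarrow> v \<in> R) \<longleftrightarrow> (\<forall>u\<in>R \<inter> S. \<forall>v\<in>S. (u, v) \<in> E' \<longrightarrow> v \<in> R)" for R
    using assms by blast
  then show ?thesis unfolding connected_in_def by simp
qed

definition minor_model :: "'a pair_pre_digraph \<Rightarrow> 'b pair_pre_digraph \<Rightarrow> ('b \<Rightarrow> 'a set) \<Rightarrow> bool" where
  "minor_model G K M \<longleftrightarrow>
     (\<forall>x\<in>pverts K. M x \<subseteq> pverts G \<and> connected_in (parcs G) (M x)) \<and>
     (\<forall>x\<in>pverts K. \<forall>y\<in>pverts K. x \<noteq> y \<longrightarrow>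
        M x \<inter> M y = {} \<and> (touches (parcs G) (M x) (M y) \<longleftrightarrow> (x, y) \<in> parcs K))"

lemma minor_model_delete:
  assumes "pair_graph H" "minor_model H K M" "v \<in> pverts H" "\<And>x. x \<in> pverts K \<Longrightarrow> v \<notin> M x"
  shows "pair_graph (delete_vertex H v)" "minor_model (delete_vertex H v) K M"
proof -
  note H = pair_graphD[OF assms(1)]
  show "pair_graph (delete_vertex H v)"
    by (rule pair_graphI) (use H in \<open>auto simp: delete_vertex_def sym_def irrefl_def\<close>)
  have e: "(a, b) \<in> parcs (delete_vertex H v) \<longleftrightarrow> (a, b) \<in> parcs H"
    if "x \<in> pverts K" "y \<in> pverts K" "a \<in> M x" "b \<in> M y" for x y a b
    using that assms(4) by (auto simp: delete_vertex_def)
  have "connected_in (parcs (delete_vertex H v)) (M x) \<longleftrightarrow> connected_in (parcs H) (M x)"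
    if "x \<in> pverts K" for x
    using that e by (intro connected_in_cong) blast
  moreover have "touches (parcs (delete_vertex H v)) (M x) (M y) \<longleftrightarrow> touches (parcs H) (M x) (M y)"
    if "x \<in> pverts K" "y \<in> pverts K" for x y
    unfolding touches_def using e[OF that] by blast
  ultimately show "minor_model (delete_vertex H v) K M"
    using assms(2,4) unfolding minor_model_def delete_vertex_def by auto
qed

text \<open>Both ends lie in one branch set, so the contraction map \<open>f\<close> respects
  membership in every branch set; connectedness and touching transfer along it.\<close>

lemma minor_model_contract:
  assumes "pair_graph H" "minor_model H K M" "z \<in> pverts K" "u \<in> M z" "v \<in> M z" "(u, v) \<in> parcs H"
  shows "pair_graph (contract_edge H u v)" "minor_model (contract_edge H u v) K (\<lambda>x. M x - {v})"
proof -
  note H = pair_graphD[OF assms(1)]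
  let ?H = "contract_edge H u v"
  define f where "f = id(v := u)"
  have uv: "u \<noteq> v" using assms(6) H(4) by (auto simp: irrefl_def)
  have uvH: "u \<in> pverts H" "v \<in> pverts H" using assms(6) H(2) by auto
  have arcs: "parcs ?H = map_prod f f ` parcs H - Id" and verts: "pverts ?H = pverts H - {v}"
    by (simp_all add: contract_edge_def f_def)
  have f: "f w \<noteq> v" "w \<noteq> v \<Longrightarrow> f w = w" "f v = u" for w using uv by (auto simp: f_def)
  show "pair_graph ?H"
  proof (rule pair_graphI)
    show "parcs ?H \<subseteq> pverts ?H \<times> pverts ?H"
      using H(2) uvH uv unfolding arcs verts f_def by (auto split: if_splits)
    show "sym (parcs ?H)"
      using H(3) unfolding arcs by (auto simp: sym_def image_iff) force
  qed (use H in \<open>auto simp: arcs verts irrefl_def\<close>)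
  have model: "\<And>x. x \<in> pverts K \<Longrightarrow> M x \<subseteq> pverts H" "\<And>x. x \<in> pverts K \<Longrightarrow> connected_in (parcs H) (M x)"
    "\<And>x y. x \<in> pverts K \<Longrightarrow> y \<in> pverts K \<Longrightarrow> x \<noteq> y \<Longrightarrow> M x \<inter> M y = {}"
    "\<And>x y. x \<in> pverts K \<Longrightarrow> y \<in> pverts K \<Longrightarrow> x \<noteq> y \<Longrightarrow>
      touches (parcs H) (M x) (M y) \<longleftrightarrow> (x, y) \<in> parcs K"
    using assms(2) unfolding minor_model_def by blast+
  have fM: "f w \<in> M x - {v} \<longleftrightarrow> w \<in> M x" if "x \<in> pverts K" for w x
  proof (cases "w = v")
    case True
    have "u \<in> M x \<longleftrightarrow> x = z" "v \<in> M x \<longleftrightarrow> x = z"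
      using model(3)[OF that assms(3)] assms(4,5) by blast+
    then show ?thesis using True f uv by simp
  next
    case False
    then show ?thesis using f by simp
  qed
  have "connected_in (parcs ?H) (M x - {v})" if x: "x \<in> pverts K" for x
    unfolding connected_in_def
  proof (intro conjI allI impI)
    obtain w where "w \<in> M x" using connected_in_nonempty[OF model(2)[OF x]] by blast
    then have "f w \<in> M x - {v}" using fM[OF x] by blast
    then show "M x - {v} \<noteq> {}" by blast
    fix R assume ne: "R \<inter> (M x - {v}) \<noteq> {}"
      and cl: "\<forall>a\<in>R \<inter> (M x - {v}). \<forall>b\<in>M x - {v}. (a, b) \<in> parcs ?H \<longrightarrow> b \<in> R"
    obtain a where a: "a \<in> R" "a \<in> M x" "a \<noteq> v" using ne by blast
    have "M x \<subseteq> {w. f w \<in> R}"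
    proof (rule connected_in_subset[OF model(2)[OF x] a(2)])
      show "a \<in> {w. f w \<in> R}" using a f by simp
      fix p q assume pq: "p \<in> {w. f w \<in> R}" "p \<in> M x" "q \<in> M x" "(p, q) \<in> parcs H"
      show "q \<in> {w. f w \<in> R}"
      proof (cases "f p = f q")
        case False
        have "(f p, f q) \<in> map_prod f f ` parcs H" using pq(4) by force
        then have "(f p, f q) \<in> parcs ?H" using False by (simp add: arcs)
        then show ?thesis using cl pq fM[OF x] by blast
      qed (use pq in auto)
    qed
    then show "M x - {v} \<subseteq> R" using f(2) by force
  qed
  moreover have "touches (parcs ?H) (M x - {v}) (M y - {v}) \<longleftrightarrow> (x, y) \<in> parcs K"
    if xy: "x \<in> pverts K" "y \<in> pverts K" "x \<noteq> y" for x y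
  proof -
    have "touches (parcs ?H) (M x - {v}) (M y - {v}) \<longleftrightarrow> touches (parcs H) (M x) (M y)"
    proof
      assume "touches (parcs ?H) (M x - {v}) (M y - {v})"
      then obtain p q where "(p, q) \<in> parcs H" "f p \<in> M x - {v}" "f q \<in> M y - {v}"
        unfolding touches_def arcs by auto
      then show "touches (parcs H) (M x) (M y)" using fM xy unfolding touches_def by blast
    next
      assume "touches (parcs H) (M x) (M y)"
      then obtain p q where pq: "(p, q) \<in> parcs H" "p \<in> M x" "q \<in> M y"
        unfolding touches_def by blast
      then have *: "f p \<in> M x - {v}" "f q \<in> M y - {v}" using fM xy by blast+
      then have "f p \<noteq> f q" using model(3)[OF xy] by auto
      then have "(f p, f q) \<in> map_prod f f ` parcs H - Id" using pq(1) by force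
      then show "touches (parcs ?H) (M x - {v}) (M y - {v})"
        using * unfolding touches_def arcs by (intro bexI[of _ "f p"] bexI[of _ "f q"])
    qed
    then show ?thesis using model(4) xy by blast
  qed
  ultimately show "minor_model ?H K (\<lambda>x. M x - {v})"
    using model(1,3) unfolding minor_model_def verts by blast
qed

lemma minor_model_singletons:
  assumes "pair_graph H" "pair_graph K" "minor_model H K M"
    and "\<And>v. v \<in> pverts H \<Longrightarrow> \<exists>x\<in>pverts K. v \<in> M x"
    and "\<And>x u v. x \<in> pverts K \<Longrightarrow> u \<in> M x \<Longrightarrow> v \<in> M x \<Longrightarrow> u = v"
  shows "digraph_iso (with_proj H) (with_proj K)"
proof -
  note H = pair_graphD[OF assms(1)] and K = pair_graphD[OF assms(2)]
  have model: "\<And>x. x \<in> pverts K \<Longrightarrow> M x \<subseteq> pverts H" "\<And>x. x \<in> pverts K \<Longrightarrow> M x \<noteq> {}"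
    "\<And>x y. x \<in> pverts K \<Longrightarrow> y \<in> pverts K \<Longrightarrow> x \<noteq> y \<Longrightarrow> M x \<inter> M y = {}"
    "\<And>x y. x \<in> pverts K \<Longrightarrow> y \<in> pverts K \<Longrightarrow> x \<noteq> y \<Longrightarrow>
      touches (parcs H) (M x) (M y) \<longleftrightarrow> (x, y) \<in> parcs K"
    using assms(3) connected_in_nonempty unfolding minor_model_def by blast+
  obtain h where h: "\<And>v. v \<in> pverts H \<Longrightarrow> h v \<in> pverts K \<and> v \<in> M (h v)"
    using assms(4) by metis
  have inj: "inj_on h (pverts H)"
    using h assms(5) by (metis inj_onI)
  have img: "h ` pverts H = pverts K"
  proof
    show "pverts K \<subseteq> h ` pverts H"
    proof
      fix x assume x: "x \<in> pverts K"
      then obtain v where v: "v \<in> M x" using model(2) by blast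
      then have "v \<in> pverts H" using model(1) x by blast
      then have "h v = x" using h[of v] model(3)[of "h v" x] x v by blast
      then show "x \<in> h ` pverts H" using \<open>v \<in> pverts H\<close> by blast
    qed
  qed (use h in blast)
  have arc: "(a, b) \<in> parcs H \<longleftrightarrow> (h a, h b) \<in> parcs K" if ab: "a \<in> pverts H" "b \<in> pverts H" for a b
  proof (cases "a = b")
    case True
    then show ?thesis using H(4) K(4) by (auto simp: irrefl_def)
  next
    case False
    then have ne: "h a \<noteq> h b" using inj ab by (auto simp: inj_on_def)
    have "M (h a) = {a}" "M (h b) = {b}" using assms(5) h ab by blast+
    then have "touches (parcs H) (M (h a)) (M (h b)) \<longleftrightarrow> (a, b) \<in> parcs H" by (simp add: touches_def)
    then show ?thesis using model(4)[OF _ _ ne] h ab by blast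
  qed
  have arcs: "map_prod h h ` parcs H = parcs K"
  proof
    show "map_prod h h ` parcs H \<subseteq> parcs K" using arc H(2) by auto
    show "parcs K \<subseteq> map_prod h h ` parcs H"
    proof
      fix e assume e: "e \<in> parcs K"
      then obtain x y where xy: "e = (x, y)" "x \<in> pverts K" "y \<in> pverts K" using K(2) by blast
      then obtain a b where "a \<in> pverts H" "b \<in> pverts H" "x = h a" "y = h b" using img by blast
      then show "e \<in> map_prod h h ` parcs H" using arc[of a b] e xy by force
    qed
  qed
  \<comment> \<open>The arcs are pairs of vertices, so the arc map is induced by \<open>h\<close>,
    and heads and tails are still the projections.\<close>
  define F where "F = \<lparr>iso_verts = h, iso_arcs = map_prod h h, iso_head = snd, iso_tail = fst\<rparr>"
  interpret pair_graph H by fact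
  have "inj_on (map_prod h h) (parcs H)"
    by (rule inj_on_subset[OF map_prod_inj_on[OF inj inj] H(2)])
  then have "pre_digraph.digraph_isomorphism (with_proj H) F"
    unfolding pre_digraph.digraph_isomorphism_def F_def using inj wf_digraph_axioms by auto
  moreover have "with_proj K = app_iso F (with_proj H)"
    unfolding app_iso_def with_proj_def F_def using img arcs by simp
  ultimately show ?thesis unfolding digraph_iso_def by blast
qed

text \<open>Delete vertices outside the branch sets and contract edges inside them; each operation
  loses a vertex. When neither applies, the branch sets are singletons covering the graph.\<close>

lemma minor_model_imp_induced_minor:
  assumes "pair_graph H" "pair_graph K" "minor_model H K M" "induced_minor G H"
  shows "has_induced_minor_iso G K"
  using assms(1,3,4)
proof (induction "card (pverts H)" arbitrary: H M rule: less_induct)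
  case less
  note H = pair_graphD[OF less.prems(1)]
  consider (del) v where "v \<in> pverts H" "\<And>x. x \<in> pverts K \<Longrightarrow> v \<notin> M x"
    | (con) x u v where "x \<in> pverts K" "u \<in> M x" "v \<in> M x" "u \<noteq> v"
    | (iso) "\<And>v. v \<in> pverts H \<Longrightarrow> \<exists>x\<in>pverts K. v \<in> M x"
        "\<And>x u v. x \<in> pverts K \<Longrightarrow> u \<in> M x \<Longrightarrow> v \<in> M x \<Longrightarrow> u = v"
    by blast
  then show ?case
  proof cases
    case del
    have "card (pverts (delete_vertex H v)) < card (pverts H)"
      using H(1) del(1) by (intro psubset_card_mono) (auto simp: delete_vertex_def)
    then show ?thesis
      using less.hyps minor_model_delete[OF less.prems(1,2) del] induced_minor.delete[OF less.prems(3) del(1)]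
      by blast
  next
    case con
    have "connected_in (parcs H) (M x)" using less.prems(2) con(1) unfolding minor_model_def by blast
    \<comment> \<open>\<open>u\<close> and \<open>v\<close> need not be adjacent; connectedness
      supplies another vertex \<open>w\<close> for the contraction.\<close>
    then have "\<exists>w\<in>M x. (u, w) \<in> parcs H"
      using connected_in_subset[of "parcs H" "M x" u "{u}"] con(2-4) by blast
    then obtain w where w: "w \<in> M x" "(u, w) \<in> parcs H" by blast
    have "card (pverts (contract_edge H u w)) < card (pverts H)"
      using H(1,2) w by (intro psubset_card_mono) (auto simp: contract_edge_def)
    then show ?thesis
      using less.hyps minor_model_contract[OF less.prems(1,2) con(1,2) w]
        induced_minor.contract[OF less.prems(3) w(2)] by blast
  next
    case iso
    then show ?thesis
      using minor_model_singletons[OF less.prems(1) assms(2) less.prems(2)] less.prems(3)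
      unfolding has_induced_minor_iso_def by blast
  qed
qed

subsection \<open>From the library notions to the abstract ones\<close>

lemma connected_iff_connected_in:
  "connected G \<longleftrightarrow> connected_in (parcs (mk_symmetric G)) (verts G)"
proof -
  let ?V = "verts G" and ?E = "parcs (mk_symmetric G)"
  have reach: "reachable (with_proj (mk_symmetric G)) u v \<longleftrightarrow> (u, v) \<in> rtrancl_on ?V ?E" for u v
    by (simp add: reachable_def mk_symmetric_def)
  have verts: "verts (with_proj (mk_symmetric G)) = ?V" by (simp add: mk_symmetric_def)
  show ?thesis
  proof
    assume c: "connected G"
    show "connected_in ?E ?V"
      unfolding connected_in_def
    proof (intro conjI allI impI)
      show "?V \<noteq> {}" using c by (simp add: connected_def strongly_connected_def verts)
      fix R assume "R \<inter> ?V \<noteq> {}" and cl: "\<forall>u\<in>R \<inter> ?V. \<forall>v\<in>?V. (u, v) \<in> ?E \<longrightarrow> v \<in> R"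
      then obtain x where x: "x \<in> R" "x \<in> ?V" by blast
      show "?V \<subseteq> R"
      proof
        fix y assume "y \<in> ?V"
        then have "(x, y) \<in> rtrancl_on ?V ?E"
          using c x unfolding connected_def strongly_connected_def verts reach by blast
        then show "y \<in> R"
          by (induction rule: rtrancl_on_induct) (use x cl in auto)
      qed
    qed
  next
    assume c: "connected_in ?E ?V"
    have "(u, v) \<in> rtrancl_on ?V ?E" if "u \<in> ?V" "v \<in> ?V" for u v
    proof -
      have "?V \<subseteq> {w. (u, w) \<in> rtrancl_on ?V ?E}"
        by (rule connected_in_subset[OF c that(1)]) (use that in \<open>auto intro: rtrancl_on_into_rtrancl_on\<close>)
      then show ?thesis using that by blast
    qed
    moreover have "?V \<noteq> {}" using c by (rule connected_in_nonempty)
    ultimately show "connected G"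
      unfolding connected_def strongly_connected_def verts reach by blast
  qed
qed

lemma connected_pair_iff:
  assumes "sym (parcs T)"
  shows "connected (with_proj T) \<longleftrightarrow> connected_in (parcs T) (pverts T)"
proof -
  have "parcs (mk_symmetric (with_proj T)) = parcs T"
    using assms by (auto simp: mk_symmetric_def sym_def)
  then show ?thesis unfolding connected_iff_connected_in by simp
qed

lemma connected_induce_iff:
  assumes "sym (parcs T)"
  shows "connected (with_proj T \<restriction> S) \<longleftrightarrow> connected_in (parcs T) S"
proof -
  have "(u, v) \<in> parcs (mk_symmetric (with_proj T \<restriction> S)) \<longleftrightarrow> (u, v) \<in> parcs T"
    if uv: "u \<in> S" "v \<in> S" for u v
  proof -
    have "(u, v) \<in> parcs (mk_symmetric (with_proj T \<restriction> S)) \<longleftrightarrow> (u, v) \<in> parcs T \<or> (v, u) \<in> parcs T"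
    proof
      assume "(u, v) \<in> parcs T \<or> (v, u) \<in> parcs T"
      then obtain a b where "(a, b) \<in> parcs T" "a \<in> S" "b \<in> S" "(u, v) \<in> {(a, b), (b, a)}"
        using uv by blast
      then show "(u, v) \<in> parcs (mk_symmetric (with_proj T \<restriction> S))"
        by (simp add: mk_symmetric_def) blast
    qed (auto simp: mk_symmetric_def)
    then show ?thesis using assms by (auto simp: sym_def)
  qed
  then have "connected_in (parcs (mk_symmetric (with_proj T \<restriction> S))) S \<longleftrightarrow> connected_in (parcs T) S"
    by (rule connected_in_cong)
  then show ?thesis unfolding connected_iff_connected_in by simp
qed

section \<open>Rooting a tree decomposition\<close>

lemma pcas_snoc: "pcas u p v \<Longrightarrow> pcas u (p @ [(v, w)]) w"
  by (induction p arbitrary: u) auto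

lemma pawalk_verts_snoc: "pcas u p v \<Longrightarrow> pawalk_verts u (p @ [(v, w)]) = pawalk_verts u p @ [w]"
  by (induction p arbitrary: u) auto

text \<open>A path from \<open>x\<close> to \<open>y\<close> avoiding \<open>s\<close> closes
  through \<open>s\<close> to a cycle. It has at least three arcs because
  \<open>x \<noteq> y\<close> makes the path nonempty.\<close>

lemma tree_neighbours_separated:
  assumes "undirected_tree T" "(s, x) \<in> parcs T" "(s, y) \<in> parcs T"
    and "y \<in> component (parcs T) (pverts T - {s}) x"
  shows "x = y"
proof (rule ccontr)
  assume ne: "x \<noteq> y"
  let ?S = "pverts T - {s}" and ?E = "parcs T"
  have "pair_graph T" using assms(1) by (simp add: undirected_tree_def)
  note T = pair_graphD[OF this]
  define H where "H = \<lparr>pverts = ?S, parcs = ?E \<inter> ?S \<times> ?S\<rparr>"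
  interpret H: pair_wf_digraph H by unfold_locales (auto simp: H_def)
  have xS: "x \<in> ?S" using assms(2) T(2,4) by (auto simp: irrefl_def)
  have "(x, y) \<in> (?E \<inter> ?S \<times> ?S)\<^sup>*" using assms(4) by (simp add: component_def)
  then have "reachable (with_proj H) x y"
  proof (induction)
    case base
    then show ?case using xS by (simp add: reachable_def H_def)
  next
    case (step a b)
    then show ?case
      unfolding reachable_def by (auto simp: H_def intro: rtrancl_on_into_rtrancl_on)
  qed
  then obtain p where p: "H.apath x p y" using H.reachable_apath by blast
  then have walk: "pcas x p y" "set p \<subseteq> ?E" "distinct (pawalk_verts x p)" "set (pawalk_verts x p) \<subseteq> ?S"
  proof -
    have a: "H.awalk x p y" "distinct (pawalk_verts x p)" using p by (simp_all add: H.apath_def)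
    then have "set (pawalk_verts x p) \<subseteq> pverts H" "set p \<subseteq> parcs H" "pcas x p y"
      by (auto elim!: H.awalkE)
    then show "pcas x p y" "set p \<subseteq> ?E" "distinct (pawalk_verts x p)" "set (pawalk_verts x p) \<subseteq> ?S"
      using a(2) by (auto simp: H_def)
  qed
  define q where "q = (s, x) # p @ [(y, s)]"
  have "p \<noteq> []" using walk(1) ne by auto
  then have len: "3 \<le> length q" by (cases p) (simp_all add: q_def)
  have arcs: "set q \<subseteq> ?E" using walk(2) assms(2,3) T(3) by (auto simp: q_def sym_def)
  have cas: "pcas s q s" using pcas_snoc[OF walk(1)] by (simp add: q_def)
  have "tl (pawalk_verts s q) = pawalk_verts x p @ [s]"
    using pawalk_verts_snoc[OF walk(1)] by (simp add: q_def)
  then have dist: "distinct (tl (pawalk_verts s q))" using walk(3,4) by auto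
  have sV: "s \<in> pverts T" using assms(2) T(2) by auto
  have "pre_digraph.cycle (with_proj T) q"
    unfolding pre_digraph.cycle_def pre_digraph.awalk_def
    using arcs cas dist sV len by (intro exI[of _ s]) (auto simp: cas_with_proj_eq awalk_verts_with_proj_eq)
  then show False using assms(1) len unfolding undirected_tree_def by blast
qed

text \<open>For an arc from \<open>s\<close> to \<open>t\<close>, \<open>side s t\<close> is the
  part of the tree beyond \<open>t\<close>. Branches are built by induction on its size, since it
  splits into \<open>t\<close> and the strictly smaller sides of the other neighbours of
  \<open>t\<close>.\<close>

lemma tree_decomposition_imp_tree_dec:
  assumes G: "pair_graph G" and td: "tree_decomposition G T B"
    and w: "\<And>s. s \<in> pverts T \<Longrightarrow> card (B s) \<le> k"
  shows "\<exists>X. tree_dec (parcs G) k (pverts G) X"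
proof -
  let ?E = "parcs G" and ?A = "parcs T" and ?V = "pverts T"
  note G' = pair_graphD[OF G]
  have tree: "undirected_tree T" using td by (simp add: tree_decomposition_def)
  then have "pair_graph T" "connected (with_proj T)" by (auto simp: undirected_tree_def)
  note T = pair_graphD[OF this(1)]
  have conT: "connected_in ?A ?V" using \<open>connected (with_proj T)\<close> connected_pair_iff[OF T(3)] by blast
  interpret T: sym_edges ?A by unfold_locales (use T(3) in \<open>auto simp: sym_def\<close>)
  have cover: "(\<Union>s\<in>?V. B s) = pverts G"
    and edge: "\<And>u v. (u, v) \<in> ?E \<Longrightarrow> \<exists>s\<in>?V. u \<in> B s \<and> v \<in> B s"
    and con: "\<And>v. v \<in> pverts G \<Longrightarrow> connected_in ?A {s \<in> ?V. v \<in> B s}"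
    using td connected_induce_iff[OF T(3)] unfolding tree_decomposition_def by blast+
  have finB: "finite (B s)" if "s \<in> ?V" for s
    using finite_subset[OF _ G'(1)] cover that by blast
  define side where "side s t = component ?A (?V - {s}) t" for s t
  define U where "U K = (\<Union>s\<in>K. B s)" for K
  have adj: "s \<in> ?V" "t \<in> ?V" "s \<noteq> t" "(t, s) \<in> ?A" if "(s, t) \<in> ?A" for s t
    using that T(2,4) T.sym_E by (auto simp: irrefl_def)
  have side: "side s t \<subseteq> ?V - {s}" "t \<in> side s t" "connected_in ?A (side s t)"
    "\<And>a b. a \<in> side s t \<Longrightarrow> b \<in> ?V \<Longrightarrow> b \<noteq> s \<Longrightarrow> (a, b) \<in> ?A \<Longrightarrow> b \<in> side s t"
    if "(s, t) \<in> ?A" for s t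
  proof -
    have m: "t \<in> ?V - {s}" using adj[OF that] by blast
    show "side s t \<subseteq> ?V - {s}" "t \<in> side s t" "connected_in ?A (side s t)"
      unfolding side_def using T.component_subset[OF m] T.component_mem T.connected_component[OF m] by auto
    show "b \<in> side s t" if "a \<in> side s t" "b \<in> ?V" "b \<noteq> s" "(a, b) \<in> ?A" for a b
      using T.component_closed[OF m, of a b] that by (auto simp: side_def)
  qed
  have unique: "x = y" if "(s, x) \<in> ?A" "(s, y) \<in> ?A" "y \<in> side s x" for s x y
    using tree_neighbours_separated[OF tree] that by (simp add: side_def)
  \<comment> \<open>The nodes holding \<open>v\<close> are connected and could leave
    \<open>side s t\<close> only along the edge from \<open>t\<close> to \<open>s\<close>, which
    would put \<open>v\<close> into both bags.\<close>
  have inside: "{x \<in> ?V. v \<in> B x} \<subseteq> side s t"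
    if st: "(s, t) \<in> ?A" and v: "v \<in> B x" "x \<in> side s t" and out: "v \<notin> B s \<or> v \<notin> B t" for s t v x
  proof (rule connected_in_subset)
    have "x \<in> ?V" using v(2) side(1)[OF st] by blast
    then show "connected_in ?A {x \<in> ?V. v \<in> B x}" "x \<in> {x \<in> ?V. v \<in> B x}"
      using con cover v(1) by blast+
    show "x \<in> side s t" by fact
    fix a b assume ab: "a \<in> side s t" "a \<in> {x \<in> ?V. v \<in> B x}" "b \<in> {x \<in> ?V. v \<in> B x}" "(a, b) \<in> ?A"
    show "b \<in> side s t"
    proof (cases "b = s")
      case True
      then have "a = t" using unique[of s t a] st ab T.sym_E by blast
      then show ?thesis using out ab True by blast
    next
      case False
      then show ?thesis using side(4)[OF st ab(1)] ab by blast
    qed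
  qed
  have border: "B s \<inter> U (side s t) \<subseteq> B t" if st: "(s, t) \<in> ?A" for s t
  proof
    fix v assume "v \<in> B s \<inter> U (side s t)"
    then obtain x where x: "v \<in> B s" "v \<in> B x" "x \<in> side s t" by (auto simp: U_def)
    show "v \<in> B t"
    proof (rule ccontr)
      assume "v \<notin> B t"
      then have "s \<in> side s t" using inside[OF st x(2,3)] x(1) adj(1)[OF st] by blast
      then show False using side(1)[OF st] by blast
    qed
  qed
  have closed: "v \<in> U (side s t)" if st: "(s, t) \<in> ?A" and u: "u \<in> U (side s t) - B s" "(u, v) \<in> ?E" for s t u v
  proof -
    obtain x where x: "u \<in> B x" "x \<in> side s t" using u by (auto simp: U_def)
    obtain y where y: "y \<in> ?V" "u \<in> B y" "v \<in> B y" using edge[OF u(2)] by blast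
    have "y \<in> side s t" using inside[OF st x] u(1) y by blast
    then show ?thesis using y by (auto simp: U_def)
  qed
  have join: "tree_dec ?E k (B t \<union> (\<Union>u\<in>N. U (side t u))) (B t)"
    if "finite N" "t \<in> ?V" "\<And>u. u \<in> N \<Longrightarrow> (t, u) \<in> ?A"
      "\<And>u. u \<in> N \<Longrightarrow> tree_dec ?E k (U (side t u)) (B u)" for t N
    using that
  proof (induction N rule: finite_induct)
    case empty
    then show ?case using tree_dec.leaf[of "B t" k ?E] finB w by simp
  next
    case (insert u N)
    have tu: "(t, u) \<in> ?A" using insert.prems by blast
    let ?S = "B t \<union> (\<Union>u\<in>N. U (side t u))" and ?S' = "U (side t u) \<union> B t"
    have 1: "tree_dec ?E k ?S (B t)" using insert by blast
    have 2: "tree_dec ?E k ?S' (B t)"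
      by (rule tree_dec.up[where Y = "B u"])
         (use insert.prems finB w border[OF tu] closed[OF tu] in auto)
    have "tree_dec ?E k (?S \<union> ?S') (B t)"
    proof (rule tree_dec.join[OF 1 2])
      show "?S \<inter> ?S' \<subseteq> B t"
      proof
        fix v assume v: "v \<in> ?S \<inter> ?S'"
        show "v \<in> B t"
        proof (rule ccontr)
          assume nv: "v \<notin> B t"
          then obtain u' x' x where x: "u' \<in> N" "v \<in> B x'" "x' \<in> side t u'" "v \<in> B x" "x \<in> side t u"
            using v by (auto simp: U_def)
          have tu': "(t, u') \<in> ?A" using insert.prems x(1) by blast
          have "x' \<in> ?V" using side(1)[OF tu'] x(3) by blast
          then have "x' \<in> side t u" using inside[OF tu x(4,5)] nv x(2) by blast
          \<comment> \<open>A vertex outside \<open>B t\<close> cannot occur on two sides of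
            \<open>t\<close>: the sides, being components, would coincide, and each contains only
            one neighbour of \<open>t\<close>.\<close>
          then have "side t u' \<subseteq> side t u"
            using connected_in_subset[OF side(3)[OF tu'] x(3)] side(1)[OF tu'] side(4)[OF tu] by blast
          then have "u = u'" using unique[OF tu tu'] side(2)[OF tu'] by blast
          then show False using insert.hyps x(1) by blast
        qed
      qed
      show "v \<in> ?S" if a: "a \<in> ?S - B t" "(a, v) \<in> ?E" for a v
      proof -
        obtain u' where "u' \<in> N" "a \<in> U (side t u') - B t" using a(1) by blast
        then show ?thesis using closed[of t u' a v] insert.prems a(2) by blast
      qed
      show "v \<in> ?S'" if "a \<in> ?S' - B t" "(a, v) \<in> ?E" for a v
        using closed[OF tu, of a v] that by blast
    qed
    moreover have "?S \<union> ?S' = B t \<union> (\<Union>u\<in>insert u N. U (side t u))" by auto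
    ultimately show ?case by simp
  qed
  have finN: "finite {u. (t, u) \<in> ?A \<and> Q u}" for t Q
    by (rule finite_subset[OF _ T(1)]) (use T(2) in auto)
  have branch: "tree_dec ?E k (U (side s t)) (B t)" if "(s, t) \<in> ?A" for s t
    using that
  proof (induction "card (side s t)" arbitrary: s t rule: less_induct)
    case less
    note st = less.prems
    define N where "N = {u. (t, u) \<in> ?A \<and> u \<noteq> s}"
    have tu: "(t, u) \<in> ?A" if "u \<in> N" for u using that by (simp add: N_def)
    have sub: "side t u \<subset> side s t" if u: "u \<in> N" for u
    proof -
      have ts: "(t, s) \<in> ?A" using adj(4)[OF st] .
      have ns: "s \<notin> side t u" using unique[OF tu[OF u] ts] u by (auto simp: N_def)
      have "u \<in> side s t" using side(4)[OF st side(2)[OF st], of u] adj[OF tu[OF u]] tu[OF u] u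
        by (simp add: N_def)
      then have "side t u \<subseteq> side s t"
        using connected_in_subset[OF side(3)[OF tu[OF u]] side(2)[OF tu[OF u]]] ns
          side(1)[OF tu[OF u]] side(4)[OF st] by blast
      moreover have "t \<in> side s t - side t u" using side(1)[OF tu[OF u]] side(2)[OF st] by blast
      ultimately show ?thesis by blast
    qed
    have eq: "side s t = {t} \<union> (\<Union>u\<in>N. side t u)"
    proof
      show "side s t \<subseteq> {t} \<union> (\<Union>u\<in>N. side t u)"
      proof (rule connected_in_subset[OF side(3)[OF st] side(2)[OF st]])
        fix a b assume ab: "a \<in> {t} \<union> (\<Union>u\<in>N. side t u)" "a \<in> side s t" "b \<in> side s t" "(a, b) \<in> ?A"
        have b: "b \<in> ?V" "b \<noteq> s" using side(1)[OF st] ab(3) by blast+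
        show "b \<in> {t} \<union> (\<Union>u\<in>N. side t u)"
        proof (cases "a = t \<or> b = t")
          case True
          then show ?thesis using ab(4) b side(2)[of t b] by (auto simp: N_def)
        next
          case False
          then obtain u where u: "u \<in> N" "a \<in> side t u" using ab(1) by blast
          then show ?thesis using side(4)[OF tu[OF u(1)] u(2) b(1)] False ab(4) by blast
        qed
      qed simp
    qed (use sub side(2)[OF st] in blast)
    have fin: "finite (side s t)" using side(1)[OF st] T(1) finite_subset by blast
    have "tree_dec ?E k (B t \<union> (\<Union>u\<in>N. U (side t u))) (B t)"
    proof (rule join)
      show "finite N" unfolding N_def by (rule finN)
      show "tree_dec ?E k (U (side t u)) (B u)" if "u \<in> N" for u
        using less.hyps[OF psubset_card_mono[OF fin sub[OF that]] tu[OF that]] .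
    qed (use adj[OF st] tu in auto)
    moreover have "U (side s t) = B t \<union> (\<Union>u\<in>N. U (side t u))" unfolding eq U_def by blast
    ultimately show ?case by simp
  qed
  obtain r where r: "r \<in> ?V" using connected_in_nonempty[OF conT] by blast
  define N where "N = {u. (r, u) \<in> ?A}"
  have "?V \<subseteq> {r} \<union> (\<Union>u\<in>N. side r u)"
  proof (rule connected_in_subset[OF conT r])
    fix a b assume ab: "a \<in> {r} \<union> (\<Union>u\<in>N. side r u)" "a \<in> ?V" "b \<in> ?V" "(a, b) \<in> ?A"
    show "b \<in> {r} \<union> (\<Union>u\<in>N. side r u)"
    proof (cases "a = r \<or> b = r")
      case True
      then show ?thesis using ab(4) side(2)[of r b] by (auto simp: N_def)
    next
      case False
      then obtain u where "(r, u) \<in> ?A" "a \<in> side r u" "u \<in> N" using ab(1) by (auto simp: N_def)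
      then show ?thesis using side(4)[of r u a b] False ab by blast
    qed
  qed simp
  moreover have "side r u \<subseteq> ?V" if "u \<in> N" for u using side(1)[of r u] that by (auto simp: N_def)
  ultimately have eq: "?V = {r} \<union> (\<Union>u\<in>N. side r u)" using r by blast
  have "tree_dec ?E k (B r \<union> (\<Union>u\<in>N. U (side r u))) (B r)"
    by (rule join) (use finN[of r "\<lambda>_. True"] r branch in \<open>auto simp: N_def\<close>)
  moreover have "U ?V = U ({r} \<union> (\<Union>u\<in>N. side r u))" using eq by simp
  then have "B r \<union> (\<Union>u\<in>N. U (side r u)) = U ?V" unfolding U_def by blast
  ultimately show ?thesis using cover unfolding U_def by auto
qed

section \<open>Paths as decomposition trees\<close>

definition nat_path :: "nat \<Rightarrow> nat pair_pre_digraph" where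
  "nat_path n = \<lparr>pverts = {..<n}, parcs = {(i, j). i < n \<and> j < n \<and> (j = Suc i \<or> i = Suc j)}\<rparr>"

lemma pair_graph_nat_path: "pair_graph (nat_path n)"
  by (rule pair_graphI) (auto simp: nat_path_def sym_def irrefl_def)

lemma connected_in_nat_path:
  assumes "S \<noteq> {}" "S \<subseteq> {..<n}" "\<And>i j l. i \<in> S \<Longrightarrow> l \<in> S \<Longrightarrow> i \<le> j \<Longrightarrow> j \<le> l \<Longrightarrow> j \<in> S"
  shows "connected_in (parcs (nat_path n)) S"
  unfolding connected_in_def
proof (intro conjI allI impI)
  fix R assume "R \<inter> S \<noteq> {}"
    and cl: "\<forall>u\<in>R \<inter> S. \<forall>v\<in>S. (u, v) \<in> parcs (nat_path n) \<longrightarrow> v \<in> R"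
  then obtain x where x: "x \<in> R" "x \<in> S" by blast
  have up: "j \<in> R" if "x \<le> j" "j \<in> S" for j
    using that
  proof (induction j rule: dec_induct)
    case (step j)
    then have "j \<in> S" using assms(3)[of x "Suc j" j] x by simp
    then show ?case using step cl assms(2) by (auto simp: nat_path_def)
  qed (use x in simp)
  have down: "j \<in> R" if "j \<le> x" "j \<in> S" for j
    using that
  proof (induction j rule: inc_induct)
    case (step j)
    then have "Suc j \<in> S" using assms(3)[of j x "Suc j"] x by simp
    then show ?case using step cl assms(2) by (auto simp: nat_path_def)
  qed (use x in simp)
  show "S \<subseteq> R" using up down by (meson nat_le_linear subsetI)
qed (use assms in simp)

lemma pcas_nth:
  assumes "pcas u p v" "p \<noteq> []"
  shows "fst (p ! 0) = u" "snd (last p) = v"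
    "\<And>i. Suc i < length p \<Longrightarrow> fst (p ! Suc i) = snd (p ! i)"
proof -
  have "fst (p ! 0) = u \<and> snd (last p) = v \<and> (\<forall>i. Suc i < length p \<longrightarrow> fst (p ! Suc i) = snd (p ! i))"
    using assms
  proof (induction p arbitrary: u)
    case (Cons e p)
    show ?case
    proof (cases "p = []")
      case False
      have "fst ((e # p) ! Suc i) = snd ((e # p) ! i)" if "Suc i < length (e # p)" for i
        using Cons.IH[of "snd e"] Cons.prems False that by (cases i) auto
      then show ?thesis using Cons.IH[of "snd e"] Cons.prems False by auto
    qed (use Cons.prems in auto)
  qed simp
  then show "fst (p ! 0) = u" "snd (last p) = v"
    "\<And>i. Suc i < length p \<Longrightarrow> fst (p ! Suc i) = snd (p ! i)" by blast+
qed

lemma tl_pawalk_verts: "tl (pawalk_verts u p) = (if p = [] then [] else map fst (tl p) @ [snd (last p)])"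
proof (induction p arbitrary: u)
  case (Cons e p)
  have "pawalk_verts w p = (if p = [] then [w] else map fst p @ [snd (last p)])" for w
    by (induction p arbitrary: w) auto
  then show ?case by simp
qed simp

text \<open>The largest vertex of a cycle would be entered from and left to the same smaller neighbour.\<close>

lemma undirected_tree_nat_path:
  assumes "0 < n"
  shows "undirected_tree (nat_path n)"
proof -
  note T = pair_graphD[OF pair_graph_nat_path[of n]]
  have "connected_in (parcs (nat_path n)) {..<n}"
    using assms by (intro connected_in_nat_path) auto
  then have "connected (with_proj (nat_path n))"
    using connected_pair_iff[OF T(3)] by (simp add: nat_path_def)
  moreover have False if cyc: "pre_digraph.cycle (with_proj (nat_path n)) p" and len: "3 \<le> length p" for p
  proof -
    obtain u where u: "pcas u p u" "set p \<subseteq> parcs (nat_path n)" "distinct (tl (pawalk_verts u p))" "p \<noteq> []"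
      using cyc unfolding pre_digraph.cycle_def pre_digraph.awalk_def
      by (auto simp: cas_with_proj_eq awalk_verts_with_proj_eq)
    define m where "m = length p"
    \<comment> \<open>The cyclic successor of an arc index; the last arc is followed by the
      first.\<close>
    define nx where "nx i = (if Suc i = m then 0 else Suc i)" for i
    note nth = pcas_nth[OF u(1,4)]
    have next_arc: "fst (p ! nx i) = snd (p ! i)" "nx i < m" if "i < m" for i
    proof -
      show "fst (p ! nx i) = snd (p ! i)"
      proof (cases "Suc i = m")
        case True
        then have "last p = p ! i" using u(4) by (metis diff_Suc_1 last_conv_nth m_def)
        then show ?thesis using nth(1,2) True by (simp add: nx_def)
      next
        case False
        then show ?thesis using nth(3)[of i] that by (simp add: nx_def m_def)
      qed
      show "nx i < m" using that len by (auto simp: nx_def m_def)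
    qed
    have heads: "map snd p = tl (pawalk_verts u p)"
    proof (rule nth_equalityI)
      show "length (map snd p) = length (tl (pawalk_verts u p))"
        using u(4) by (simp add: tl_pawalk_verts)
      fix i assume "i < length (map snd p)"
      then have i: "i < length p" by simp
      show "map snd p ! i = tl (pawalk_verts u p) ! i"
      proof (cases "Suc i = length p")
        case True
        then have "last p = p ! i" using u(4) by (metis diff_Suc_1 last_conv_nth)
        moreover have "\<not> i < length p - Suc 0" using True by simp
        ultimately show ?thesis using True u(4) i by (simp add: tl_pawalk_verts nth_append)
      next
        case False
        then have "Suc i < length p" using i by simp
        moreover have "i < length p - Suc 0" using calculation by simp
        ultimately show ?thesis using nth(3) u(4) i by (simp add: tl_pawalk_verts nth_append nth_tl)
      qed
    qed
    have "distinct (map snd p)" unfolding heads by (rule u(3))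
    then have inj: "i = j" if "i < m" "j < m" "snd (p ! i) = snd (p ! j)" for i j
      using that nth_eq_iff_index_eq[of "map snd p" i j] by (simp add: m_def)
    have arc: "snd (p ! i) = Suc (fst (p ! i)) \<or> fst (p ! i) = Suc (snd (p ! i))" if "i < m" for i
    proof -
      have "p ! i \<in> parcs (nat_path n)" using u(2) that by (auto simp: m_def)
      then show ?thesis by (auto simp: nat_path_def)
    qed
    let ?M = "Max (snd ` set p)"
    have "?M \<in> snd ` set p" using u(4) by (intro Max_in) auto
    then obtain i where i: "i < m" "snd (p ! i) = ?M" by (auto simp: m_def in_set_conv_nth)
    have le: "snd (p ! j) \<le> ?M" if "j < m" for j using that by (intro Max_ge) (auto simp: m_def)
    obtain j where j: "j < m" "nx j = i"
    proof (cases i)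
      case 0
      then show ?thesis using that[of "m - 1"] len by (auto simp: nx_def m_def)
    next
      case (Suc i')
      then show ?thesis using that[of i'] i(1) by (auto simp: nx_def)
    qed
    have "fst (p ! i) = snd (p ! j)" using next_arc(1)[OF j(1)] j(2) by simp
    then have a: "?M = Suc (snd (p ! j))" using arc[OF i(1)] i(2) le[OF j(1)] by auto
    have "fst (p ! nx i) = ?M" using next_arc(1)[OF i(1)] i(2) by simp
    then have b: "?M = Suc (snd (p ! nx i))"
      using arc[OF next_arc(2)[OF i(1)]] le[OF next_arc(2)[OF i(1)]] by auto
    \<comment> \<open>The arcs before and after arc \<open>i\<close> have the same head, so they are
      the same arc and the cycle has length two.\<close>
    have "nx i = j" using inj[OF next_arc(2)[OF i(1)] j(1)] a b by simp
    then show False using j len i(1) by (auto simp: nx_def m_def split: if_splits)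
  qed
  ultimately show ?thesis using pair_graph_nat_path unfolding undirected_tree_def by blast
qed

lemma undirected_path_nat_path:
  assumes "0 < n"
  shows "undirected_path (nat_path n)"
proof -
  have "zip [0..<n] (tl [0..<n]) = map (\<lambda>i. (i, Suc i)) [0..<n - 1]"
    by (rule nth_equalityI) (auto simp: nth_tl)
  then have "set (zip [0..<n] (tl [0..<n])) = {(i, Suc i) | i. Suc i < n}" by auto
  moreover have "{(i, j). i < n \<and> j < n \<and> (j = Suc i \<or> i = Suc j)} =
      {(i, Suc i) | i. Suc i < n} \<union> {(i, Suc i) | i. Suc i < n}\<inverse>" by auto
  ultimately show ?thesis
    using assms unfolding undirected_path_def nat_path_def
    by (intro exI[of _ "[0..<n]"]) auto
qed

lemma path_dec_imp_path_decomposition: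
  assumes G: "pair_graph G" and "path_dec (parcs G) (pverts G) k Bs"
  shows "path_decomposition G (nat_path (length Bs)) (\<lambda>i. Bs ! i)"
    and "decomposition_width (nat_path (length Bs)) (\<lambda>i. Bs ! i) \<le> int k - 1"
proof -
  let ?P = "nat_path (length Bs)"
  have Bs: "Bs \<noteq> []" "path_bags Bs" "\<Union>(set Bs) = pverts G"
    "\<And>u v. u \<in> pverts G \<Longrightarrow> v \<in> pverts G \<Longrightarrow> (u, v) \<in> parcs G \<Longrightarrow> \<exists>B\<in>set Bs. u \<in> B \<and> v \<in> B"
    "\<And>B. B \<in> set Bs \<Longrightarrow> card B \<le> k"
    using assms unfolding path_dec_def by auto
  have n: "0 < length Bs" using Bs(1) by simp
  have verts: "pverts ?P = {..<length Bs}" by (simp add: nat_path_def)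
  have "(\<Union>t\<in>pverts ?P. Bs ! t) = pverts G"
  proof -
    have "set Bs = (!) Bs ` {..<length Bs}" by (auto simp: set_conv_nth)
    then show ?thesis unfolding verts Bs(3)[symmetric] by simp
  qed
  moreover have "\<exists>t\<in>pverts ?P. u \<in> Bs ! t \<and> v \<in> Bs ! t" if uv: "(u, v) \<in> parcs G" for u v
  proof -
    have "u \<in> pverts G" "v \<in> pverts G" using uv pair_graphD(2)[OF G] by auto
    then obtain B where "B \<in> set Bs" "u \<in> B" "v \<in> B" using Bs(4) uv by blast
    then show ?thesis unfolding verts by (auto simp: in_set_conv_nth)
  qed
  moreover have "connected (with_proj ?P \<restriction> {t \<in> pverts ?P. v \<in> Bs ! t})" if v: "v \<in> pverts G" for v
  proof -
    have "connected_in (parcs ?P) {t \<in> pverts ?P. v \<in> Bs ! t}"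
      unfolding verts
    proof (rule connected_in_nat_path)
      obtain B where "B \<in> set Bs" "v \<in> B" using v unfolding Bs(3)[symmetric] by blast
      then show "{t \<in> {..<length Bs}. v \<in> Bs ! t} \<noteq> {}" by (auto simp: in_set_conv_nth)
      fix i j l assume "i \<in> {t \<in> {..<length Bs}. v \<in> Bs ! t}" "l \<in> {t \<in> {..<length Bs}. v \<in> Bs ! t}" "i \<le> j" "j \<le> l"
      then show "j \<in> {t \<in> {..<length Bs}. v \<in> Bs ! t}"
        using path_bags_interval[OF Bs(2), of i j l] by auto
    qed blast
    then show ?thesis using connected_induce_iff[OF pair_graphD(3)[OF pair_graph_nat_path]] by blast
  qed
  ultimately show "path_decomposition G ?P (\<lambda>i. Bs ! i)"
    unfolding path_decomposition_def tree_decomposition_def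
    using undirected_path_nat_path[OF n] undirected_tree_nat_path[OF n] by blast
  have "(MAX t\<in>pverts ?P. card (Bs ! t)) \<le> k"
    unfolding verts using n Bs(5) by (subst Max_le_iff) auto
  then show "decomposition_width ?P (\<lambda>i. Bs ! i) \<le> int k - 1"
    by (simp add: decomposition_width_def)
qed

lemma pathwidth_le:
  assumes "pair_graph G" "pw_le (parcs G) (pverts G) k"
  shows "pathwidth G \<le> int k - 1"
proof -
  let ?W = "{decomposition_width P B | (P :: nat pair_pre_digraph) B. path_decomposition G P B}"
  obtain Bs where Bs: "path_dec (parcs G) (pverts G) k Bs" using assms(2) by (auto simp: pw_le_def)
  have "bdd_below ?W"
    by (rule bdd_belowI[of _ "-1"]) (auto simp: decomposition_width_def)
  moreover have "decomposition_width (nat_path (length Bs)) (\<lambda>i. Bs ! i) \<in> ?W"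
    using path_dec_imp_path_decomposition(1)[OF assms(1) Bs] by blast
  ultimately have "pathwidth G \<le> decomposition_width (nat_path (length Bs)) (\<lambda>i. Bs ! i)"
    unfolding pathwidth_def by (intro cInf_lower)
  then show ?thesis using path_dec_imp_path_decomposition(2)[OF assms(1) Bs] by linarith
qed

lemma treewidth_less_imp_tree_decomposition:
  assumes "pair_graph G" "treewidth G < int k"
  obtains T :: "nat pair_pre_digraph" and B where "tree_decomposition G T B"
    "\<And>s. s \<in> pverts T \<Longrightarrow> card (B s) \<le> k"
proof -
  let ?W = "{decomposition_width T B | (T :: nat pair_pre_digraph) B. tree_decomposition G T B}"
  \<comment> \<open>The decomposition with one bag makes the set of widths nonempty, which is needed
    to extract an element below \<open>k\<close> from the infimum. Width less than \<open>k\<close>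
    means bags of size at most \<open>k\<close>.\<close>
  have "path_dec (parcs G) (pverts G) (card (pverts G)) [pverts G]"
    using path_dec_single pair_graphD(1)[OF assms(1)] by blast
  then have "tree_decomposition G (nat_path 1) (\<lambda>i. [pverts G] ! i)"
    using path_dec_imp_path_decomposition(1)[OF assms(1)] unfolding path_decomposition_def by fastforce
  then have "?W \<noteq> {}" by blast
  then obtain T :: "nat pair_pre_digraph" and B where
    td: "tree_decomposition G T B" "decomposition_width T B < int k"
    using cInf_lessD[of ?W "int k"] assms(2) unfolding treewidth_def by blast
  have "finite (pverts T)"
    using td(1) pair_graphD(1)[of T] by (simp add: tree_decomposition_def undirected_tree_def)
  then have "card (B s) \<le> (MAX s\<in>pverts T. card (B s))" if "s \<in> pverts T" for s
    using that by (intro Max_ge) auto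
  then have "card (B s) \<le> k" if "s \<in> pverts T" for s
    using that td(2) unfolding decomposition_width_def by fastforce
  then show ?thesis using that td(1) by blast
qed

lemma pair_graph_bin: "pair_graph (bin r)"
proof (rule pair_graphI)
  have "finite {xs :: bool list. set xs \<subseteq> UNIV \<and> length xs \<le> r}"
    by (rule finite_lists_length_le) simp
  then show "finite (pverts (bin r))" by (simp add: bin_def Let_def)
qed (auto simp: bin_def Let_def sym_def irrefl_def)

lemma bin_model_imp_minor_model:
  assumes "normal_tree (parcs G) d n W C" "C [] \<subseteq> pverts G" "bin_model (parcs G) r d n W"
  shows "\<exists>M. minor_model G (bin r) M"
proof -
  obtain \<phi> :: "bool list \<Rightarrow> nat list" where \<phi>: "inj_on \<phi> {b. length b \<le> r}"
    "\<And>b. length b \<le> r \<Longrightarrow> \<phi> b \<in> nodes d n"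
    "\<And>a b. length a \<le> r \<Longrightarrow> length b \<le> r \<Longrightarrow> a \<noteq> b \<Longrightarrow>
           (touches (parcs G) (W (\<phi> a)) (W (\<phi> b)) \<longleftrightarrow> (\<exists>c. a = c # b \<or> b = c # a))"
    using assms(3) unfolding bin_model_def by blast
  have verts: "pverts (bin r) = {b. length b \<le> r}" by (simp add: bin_def Let_def)
  have arcs: "(a, b) \<in> parcs (bin r) \<longleftrightarrow> (\<exists>c. a = c # b \<or> b = c # a)"
    if "length a \<le> r" "length b \<le> r" for a b
    using that by (auto simp: bin_def Let_def)
  have "W x \<subseteq> pverts G" if x: "x \<in> nodes d n" for x
    using normal_treeD(3)[OF assms(1) x] normal_tree_mono[OF assms(1), of "[]" x] assms(2) x by auto
  then have "minor_model G (bin r) (\<lambda>b. W (\<phi> b))"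
    unfolding minor_model_def verts
    using \<phi> arcs normal_treeD(1)[OF assms(1)] normal_tree_disjoint[OF assms(1)]
    by (simp add: inj_on_eq_iff)
  then show ?thesis by blast
qed

subsection \<open>The bound\<close>

text \<open>Here \<open>t ^ (2 * q)\<close> bounds the height and \<open>2 ^ M\<close> is the arity.
  \<open>M\<close> results from replacing \<open>t + 2\<close> and \<open>t\<close> by
  \<open>2 ^ t\<close> in the arity required. With \<open>M \<le> t ^ (2 * q + 3)\<close> and
  \<open>3 * t + 1 \<le> t ^ 3\<close> the product has exponent \<open>4 * q + 6\<close>, within the
  allowed \<open>6 * q + 8\<close>.\<close>

lemma threshold_bound:
  fixes t q :: nat
  assumes "2 \<le> t"
  defines "M \<equiv> t * (1 + 2 * q * (q + t + 2))"
  shows "(t + 2) * (t ^ (2 * q)) ^ (Suc q + (t + 1)) \<le> 2 ^ M"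
    and "t ^ (2 * q) * (M * (3 * t + 1)) \<le> t ^ (6 * Suc q + 2)"
proof -
  have t2: "t \<le> 2 ^ t" by (rule less_imp_le[OF less_exp])
  have "t + 2 \<le> 2 ^ t"
    using assms(1)
  proof (induction t rule: dec_induct)
    case (step n)
    then show ?case by simp
  qed simp
  moreover have "(t ^ (2 * q)) ^ (Suc q + (t + 1)) \<le> ((2 ^ t) ^ (2 * q)) ^ (Suc q + (t + 1))"
    using t2 by (intro power_mono) auto
  ultimately have "(t + 2) * (t ^ (2 * q)) ^ (Suc q + (t + 1)) \<le>
      2 ^ t * ((2 ^ t) ^ (2 * q)) ^ (Suc q + (t + 1))"
    by (rule mult_le_mono)
  also have "\<dots> = 2 ^ M"
    by (simp add: M_def power_mult[symmetric] power_add[symmetric] algebra_simps)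
  finally show "(t + 2) * (t ^ (2 * q)) ^ (Suc q + (t + 1)) \<le> 2 ^ M" .
  have q1: "q + 1 \<le> 2 ^ q" by (induction q) auto
  have "q + t + 2 \<le> t * (q + 2)"
  proof -
    obtain s where "t = s + 2" using assms(1) by (metis le_iff_add add.commute)
    then show ?thesis by (simp add: algebra_simps)
  qed
  then have "2 * q * (q + t + 2) \<le> 2 * q * (t * (q + 2))" by (rule mult_le_mono2)
  then have "1 + 2 * q * (q + t + 2) \<le> t * 1 + 2 * q * (t * (q + 2))" using assms(1) by linarith
  also have "\<dots> = t * (2 * q\<^sup>2 + 4 * q + 1)" by (simp add: algebra_simps power2_eq_square)
  also have "\<dots> \<le> t * (2 * (q + 1)\<^sup>2)" by (intro mult_le_mono2) (simp add: power2_eq_square algebra_simps)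
  also have "\<dots> \<le> t * (t * (t ^ q)\<^sup>2)"
  proof (intro mult_le_mono2 mult_le_mono)
    have "q + 1 \<le> t ^ q" using q1 power_mono[OF assms(1), of q] by linarith
    then show "(q + 1)\<^sup>2 \<le> (t ^ q)\<^sup>2" by (intro power_mono) auto
  qed (fact assms(1))
  also have "\<dots> = t ^ (2 * q + 2)" by (simp add: power_add power_even_eq power2_eq_square)
  finally have a: "1 + 2 * q * (q + t + 2) \<le> t ^ (2 * q + 2)" .
  have "3 * t + 1 \<le> 4 * t" using assms(1) by linarith
  also have "\<dots> \<le> (t * t) * t" using mult_le_mono[OF assms(1) assms(1)] by (intro mult_le_mono1) simp
  also have "\<dots> = t ^ 3" by (simp add: power3_eq_cube)
  finally have b: "3 * t + 1 \<le> t ^ 3" .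
  have "t ^ (2 * q) * (M * (3 * t + 1)) \<le> t ^ (2 * q) * ((t * t ^ (2 * q + 2)) * t ^ 3)"
    unfolding M_def using a b by (intro mult_le_mono2 mult_le_mono) auto
  also have "\<dots> = t ^ (2 * q + ((1 + (2 * q + 2)) + 3))" by (simp only: power_add power_one_right)
  also have "\<dots> \<le> t ^ (6 * Suc q + 2)" using assms(1) by (intro power_increasing) auto
  finally show "t ^ (2 * q) * (M * (3 * t + 1)) \<le> t ^ (6 * Suc q + 2)" .
qed

theorem theorem3p1:
  fixes \<rho> \<tau> :: nat and G :: "'a pair_pre_digraph"
  assumes "0 < \<rho>" and "0 < \<tau>"
    and "pair_graph G"
    and "treewidth G < int \<tau>"
    and "\<not> has_induced_minor_iso G (bin \<rho>)"
  shows "pathwidth G < int (\<tau> ^ (6 * \<rho> + 2))"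
proof (rule ccontr)
  assume wide: "\<not> pathwidth G < int (\<tau> ^ (6 * \<rho> + 2))"
  let ?E = "parcs G" and ?V = "pverts G"
  note G = pair_graphD[OF assms(3)]
  interpret sym_edges ?E by unfold_locales (use G(3) in \<open>auto simp: sym_def\<close>)
  obtain T :: "nat pair_pre_digraph" and B where td: "tree_decomposition G T B"
    and bags: "\<And>s. s \<in> pverts T \<Longrightarrow> card (B s) \<le> \<tau>"
    using treewidth_less_imp_tree_decomposition[OF assms(3,4)] by blast
  have "\<not> pw_le ?E ?V (\<tau> ^ (6 * \<rho> + 2))"
    using pathwidth_le[OF assms(3)] wide by fastforce
  from big_component[OF G(1) this] obtain D where
    D: "D \<subseteq> ?V" "connected_in ?E D" "\<not> pw_le ?E D (\<tau> ^ (6 * \<rho> + 2))" .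
  obtain p where p: "p \<in> D" using connected_in_nonempty[OF D(2)] by blast
  show False
  proof (cases "\<tau> = 1")
    \<comment> \<open>The estimates need \<tau> to be at least 2. For \<tau> = 1 the claimed bound
      is 1, and bags with at most one vertex leave no edges, so \<open>D\<close> is a single
      vertex.\<close>
    case True
    have "?E = {}"
    proof (rule ccontr)
      assume "?E \<noteq> {}"
      then obtain u v where uv: "(u, v) \<in> ?E" by auto
      then obtain s where s: "s \<in> pverts T" "u \<in> B s" "v \<in> B s"
        using td unfolding tree_decomposition_def by blast
      have "B s \<subseteq> ?V" using td s(1) unfolding tree_decomposition_def by blast
      then have "finite (B s)" using G(1) finite_subset by blast
      moreover have "{u, v} \<subseteq> B s" using s by blast
      ultimately have "card {u, v} \<le> card (B s)" by (rule card_mono)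
      also have "\<dots> \<le> 1" using bags[OF s(1)] True by simp
      finally show False using uv G(4) by (auto simp: irrefl_def card_insert_if split: if_splits)
    qed
    then have "D \<subseteq> {p}" using connected_in_subset[OF D(2) p, of "{p}"] by simp
    then have "D = {p}" using p by blast
    then have "pw_le ?E D 1" unfolding pw_le_def using path_dec_single[of "{p}" 1] by auto
    then show False using D(3) True by simp
  next
    case False
    then have \<tau>: "2 \<le> \<tau>" using assms(2) by linarith
    obtain q where q: "\<rho> = Suc q" using assms(1) by (cases \<rho>) auto
    obtain X where "tree_dec ?E \<tau> ?V X"
      using tree_decomposition_imp_tree_dec[OF assms(3) td bags] by blast
    then interpret bounded_tree_dec ?E ?V X \<tau> by unfold_locales (use G(1) in auto)
    \<comment> \<open>\<open>N\<close> comes from the estimate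
      \<open>(\<tau> + 2) ^ q \<le> (\<tau>\<^sup>2) ^ q\<close> for the required height.\<close>
    define N where "N = \<tau> ^ (2 * q)"
    define M where "M = \<tau> * (1 + 2 * q * (q + \<tau> + 2))"
    define n where "n = ramsey_height \<rho> (\<tau> + 1)"
    have "n \<le> (\<tau> + 2) ^ q" using ramsey_height_le[of q "\<tau> + 1"] by (simp add: n_def q)
    also have "\<dots> \<le> (\<tau>\<^sup>2) ^ q"
    proof (rule power_mono)
      have "\<tau> + 2 \<le> 2 * \<tau>" using \<tau> by simp
      also have "\<dots> \<le> \<tau>\<^sup>2" using \<tau> by (simp add: power2_eq_square)
      finally show "\<tau> + 2 \<le> \<tau>\<^sup>2" .
    qed simp
    finally have nN: "n \<le> N" by (simp add: N_def power_mult)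
    have "0 < M" using \<tau> by (simp add: M_def)
    then obtain m where m: "M = m + 1" by (metis Suc_eq_plus1 gr0_implies_Suc)
    have "n * ((m + 1) * (3 * \<tau> + 1)) \<le> N * (M * (3 * \<tau> + 1))"
      unfolding m[symmetric] using nN by (rule mult_le_mono1)
    also have "\<dots> \<le> \<tau> ^ (6 * \<rho> + 2)"
      using threshold_bound(2)[OF \<tau>, of q] by (simp add: N_def M_def q)
    finally have "\<not> pw_le ?E D (n * ((m + 1) * (3 * \<tau> + 1)))" using D(3) pw_le_mono by blast
    from normal_tree_exists[OF D(1,2) p this] obtain W C where
      W: "normal_tree ?E (2 ^ (m + 1)) n W C" "C [] = D" by (elim exE conjE)
    have "bin_model ?E \<rho> (2 ^ (m + 1)) n W"
    \<comment> \<open>No ancestor has been passed yet, so \<open>s = 0\<close>, all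
      \<open>\<tau> + 1\<close> places are free, and the family \<open>P\<close> is a dummy.\<close>
    proof (rule ramsey_bin_model[OF W(1), of 0 "\<tau> + 1" "\<lambda>_. {}" \<rho> N])
      show "(\<tau> + 2) * N ^ (\<rho> + (\<tau> + 1)) \<le> 2 ^ (m + 1)"
        using threshold_bound(1)[OF \<tau>, of q] unfolding N_def M_def[symmetric] m q .
      show "0 < N" using \<tau> by (simp add: N_def)
    qed (use W D(1) nN n_def in auto)
    then obtain K where "minor_model G (bin \<rho>) K"
      using bin_model_imp_minor_model[OF W(1)] W(2) D(1) by blast
    then have "has_induced_minor_iso G (bin \<rho>)"
      using minor_model_imp_induced_minor[OF assms(3) pair_graph_bin _ induced_minor.refl] by blast
    then show False using assms(5) by blast
  qed
qed

end
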